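(* Let $(E,d)$ be a Polish space and let $L$ be the infinitesimal generator of a pure jump non-explosive Markov process on $E$ defined, for any bounded measurable function $f:E\rightarrow\mathbb{R}$, by $$Lf(x)=\int_E (f(u)-f(x))\,q(x,du),\quad \forall x\in E,$$ where $(q(x,du))_{x\in E}$ is a jump kernel of finite non-negative measures with $q(x,\cdot)\in\mathcal{M}_d(E)$ for all $x\in E$. Then the coarse Ricci curvature $\sigma$ of the Markov process generated by $L$ satisfies $$\sigma\geq -\sup_{x\neq y\in E} \frac{J_d^{x,y}\left(q(x,\cdot),q(y,\cdot)\right)}{d(x,y)}.$$
   Context: $\mathcal{M}_d(E)$ is the set of finite non-negative measures $m$ on $E$ such that $\int_E d(x,y)\,m(dy)<\infty$ for some (equivalently all) $x\in E$. For non-negative measures $\mu,\nu$ on $E$ with the same finite mass, $\mathcal{W}_d(\mu,\nu)=\inf_\pi\int_{E\times E} d(u,v)\,\pi(du,dv)$, the infimum being over non-negative measures $\pi$ on $E\times E$ with marginals $\mu$ and $\nu$. For $x,y\in E$ and $m_1,m_2\in\mathcal{M}_d(E)$, $$J_{d}^{x,y}(m_1,m_2)=\mathcal{W}_d\bigl(m_1+m_2(E)\delta_x,\ m_2+m_1(E)\delta_y\bigr)-\bigl(m_1(E)+m_2(E)\bigr)d(x,y).$$ The coarse Ricci curvature of a Markov process $X$ on $E$ is the largest $\sigma\in[-\infty,+\infty]$ such that, for all $t\geq0$ and all $x,y\in E$, $\mathcal{W}_d\bigl(\mathbb{P}(X_t\in\cdot\mid X_0=x),\mathbb{P}(X_t\in\cdot\mid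 X_0=y)\bigr)\leq e^{-\sigma t}d(x,y)$. *)

theory Defs
  imports "HOL-Probability.Probability"
begin

text \<open>
  The Polish space \<open>(E, d)\<close> is a type of class \<^class>\<open>polish_space\<close> (complete, separable metric space)
  with \<open>d\<close> = \<^const>\<open>dist\<close>; all measures on \<open>E\<close> live on its Borel sigma-algebra.
\<close>

subsection \<open>Measures, transport distance and the functional \<open>J\<close>\<close>

definition finite_first_moment :: "'a::polish_space measure set" where
  "finite_first_moment =
     {m. sets m = sets borel \<and> finite_measure m \<and> (\<exists>x. (\<integral>\<^sup>+y. ennreal (dist x y) \<partial>m) < \<infinity>)}"

definition add_measure :: "'a measure \<Rightarrow> 'a measure \<Rightarrow> 'a measure" where
  "add_measure \<mu> \<nu> = measure_of (space \<mu>) (sets \<mu>) (\<lambda>A. emeasure \<mu> A + emeasure \<nu> A)"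

lemma sets_add_measure [simp]: "sets (add_measure \<mu> \<nu>) = sets \<mu>"
  by (simp add: add_measure_def)

lemma emeasure_add_measure:
  assumes "sets \<nu> = sets \<mu>" and "A \<in> sets \<mu>"
  shows "emeasure (add_measure \<mu> \<nu>) A = emeasure \<mu> A + emeasure \<nu> A"
  unfolding add_measure_def
proof (rule emeasure_measure_of_sigma)
  show "sigma_algebra (space \<mu>) (sets \<mu>)" ..
  show "positive (sets \<mu>) (\<lambda>A. emeasure \<mu> A + emeasure \<nu> A)"
    by (simp add: positive_def)
  show "countably_additive (sets \<mu>) (\<lambda>A. emeasure \<mu> A + emeasure \<nu> A)"
  proof (rule countably_additiveI)
    fix F :: "nat \<Rightarrow> 'a set"
    assume F: "range F \<subseteq> sets \<mu>" "disjoint_family F"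
    have "(\<Sum>i. emeasure \<mu> (F i) + emeasure \<nu> (F i))
        = (\<Sum>i. emeasure \<mu> (F i)) + (\<Sum>i. emeasure \<nu> (F i))"
      by (intro suminf_add [symmetric]) auto
    also have "\<dots> = emeasure \<mu> (\<Union>i. F i) + emeasure \<nu> (\<Union>i. F i)"
      using F assms(1) by (simp add: suminf_emeasure)
    finally show "(\<Sum>i. emeasure \<mu> (F i) + emeasure \<nu> (F i))
        = emeasure \<mu> (\<Union>i. F i) + emeasure \<nu> (\<Union>i. F i)" .
  qed
qed (rule assms(2))

definition couplings :: "'a::polish_space measure \<Rightarrow> 'a measure \<Rightarrow> ('a \<times> 'a) measure set" where
  "couplings \<mu> \<nu> = {\<pi>. sets \<pi> = sets (borel \<Otimes>\<^sub>M borel) \<and> distr \<pi> borel fst = \<mu> \<and> distr \<pi> borel snd = \<nu>}"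

text \<open>Only meaningful for measures of the same finite mass; the value may be \<open>\<infinity>\<close>.\<close>

definition Wass :: "'a::polish_space measure \<Rightarrow> 'a measure \<Rightarrow> ennreal" where
  "Wass \<mu> \<nu> = (INF \<pi>\<in>couplings \<mu> \<nu>. \<integral>\<^sup>+p. ennreal (dist (fst p) (snd p)) \<partial>\<pi>)"

definition J :: "'a::polish_space \<Rightarrow> 'a \<Rightarrow> 'a measure \<Rightarrow> 'a measure \<Rightarrow> ereal" where
  "J x y m1 m2 =
     enn2ereal (Wass (add_measure m1 (scale_measure (emeasure m2 UNIV) (return borel x)))
                     (add_measure m2 (scale_measure (emeasure m1 UNIV) (return borel y))))
     - ereal ((measure m1 UNIV + measure m2 UNIV) * dist x y)"


subsection \<open>Markov processes\<close>

text \<open>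
  A process is given by the family \<open>P x\<close> of its laws (on a common measurable space) when started
  from \<open>x\<close>, and the random variables \<open>X t\<close>, which are only relevant for \<open>t \<ge> 0\<close>.
\<close>

definition transition :: "('a::polish_space \<Rightarrow> 'w measure) \<Rightarrow> (real \<Rightarrow> 'w \<Rightarrow> 'a) \<Rightarrow> real \<Rightarrow> 'a \<Rightarrow> 'a measure" where
  "transition P X t x = distr (P x) borel (X t)"

definition history :: "'w measure \<Rightarrow> (real \<Rightarrow> 'w \<Rightarrow> 'a::polish_space) \<Rightarrow> real \<Rightarrow> 'w set set" where
  "history \<Omega> X s =
     sigma_sets (space \<Omega>) {X r -` B \<inter> space \<Omega> | r B. 0 \<le> r \<and> r \<le> s \<and> B \<in> sets borel}"

text \<open>
  The last condition is the (time-homogeneous) Markov property with respect to the natural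
  filtration: conditionally on the history up to time \<open>s\<close>, \<open>X (s + t)\<close> has law \<open>transition P X t (X s)\<close>.
\<close>

definition markov_process ::
    "'w measure \<Rightarrow> ('a::polish_space \<Rightarrow> 'w measure) \<Rightarrow> (real \<Rightarrow> 'w \<Rightarrow> 'a) \<Rightarrow> bool" where
  "markov_process \<Omega> P X \<longleftrightarrow>
     (\<forall>x. prob_space (P x) \<and> sets (P x) = sets \<Omega>) \<and>
     (\<forall>t\<ge>0. X t \<in> measurable \<Omega> borel) \<and>
     (\<forall>x. AE \<omega> in P x. X 0 \<omega> = x) \<and>
     (\<forall>t\<ge>0. transition P X t \<in> measurable borel (prob_algebra borel)) \<and>
     (\<forall>x. \<forall>s\<ge>0. \<forall>t\<ge>0. \<forall>A\<in>history \<Omega> X s. \<forall>B\<in>sets borel.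
        emeasure (P x) {\<omega>\<in>A. X (s + t) \<omega> \<in> B} =
        (\<integral>\<^sup>+\<omega>\<in>A. emeasure (transition P X t (X s \<omega>)) B \<partial>P x))"

text \<open>
  Right-continuous step functions on \<open>[0, \<infinity>)\<close> with finitely many jumps in every bounded interval.
  The times \<open>\<tau> n\<close> contain all jump times, but need not all be proper jumps; this covers absorption.
\<close>

definition step_path :: "(real \<Rightarrow> 'a) \<Rightarrow> bool" where
  "step_path p \<longleftrightarrow>
     (\<exists>\<tau> :: nat \<Rightarrow> real. \<tau> 0 = 0 \<and> incseq \<tau> \<and> filterlim \<tau> at_top sequentially \<and>
        (\<forall>n. \<forall>t\<in>{\<tau> n..<\<tau> (Suc n)}. p t = p (\<tau> n)))"

definition pure_jump_nonexplosive ::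
    "('a::polish_space \<Rightarrow> 'w measure) \<Rightarrow> (real \<Rightarrow> 'w \<Rightarrow> 'a) \<Rightarrow> bool" where
  "pure_jump_nonexplosive P X \<longleftrightarrow> (\<forall>x. AE \<omega> in P x. step_path (\<lambda>t. X t \<omega>))"

text \<open>
  For unbounded jump rates, \<open>L f\<close> need not be bounded, so the generator is the pointwise derivative
  at time 0 of the transition semigroup, on all bounded measurable functions.
\<close>

definition has_generator ::
    "('a::polish_space \<Rightarrow> 'w measure) \<Rightarrow> (real \<Rightarrow> 'w \<Rightarrow> 'a) \<Rightarrow> (('a \<Rightarrow> real) \<Rightarrow> 'a \<Rightarrow> real) \<Rightarrow> bool" where
  "has_generator P X L \<longleftrightarrow>
     (\<forall>f. f \<in> borel_measurable borel \<and> bounded (range f) \<longrightarrow>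
       (\<forall>x. ((\<lambda>t. ((\<integral>\<omega>. f (X t \<omega>) \<partial>P x) - f x) / t) \<longlongrightarrow> L f x) (at_right 0)))"

definition jump_kernel :: "('a::polish_space \<Rightarrow> 'a measure) \<Rightarrow> bool" where
  "jump_kernel q \<longleftrightarrow>
     (\<forall>x. sets (q x) = sets borel \<and> finite_measure (q x)) \<and>
     (\<forall>A\<in>sets borel. (\<lambda>x. emeasure (q x) A) \<in> borel_measurable borel)"

definition jump_generator :: "('a::polish_space \<Rightarrow> 'a measure) \<Rightarrow> ('a \<Rightarrow> real) \<Rightarrow> 'a \<Rightarrow> real" where
  "jump_generator q f x = (\<integral>u. (f u - f x) \<partial>q x)"


subsection \<open>Coarse Ricci curvature\<close>

fun exp_ext :: "ereal \<Rightarrow> ennreal" where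
  "exp_ext (ereal r) = ennreal (exp r)"
| "exp_ext PInfty = \<infinity>"
| "exp_ext MInfty = 0"

text \<open>
  The set below is closed and contains \<open>-\<infinity>\<close>, so its supremum is its largest element.
  As usual \<open>\<infinity> * 0 = 0\<close>, both in the exponent (for \<open>t = 0\<close>) and on the right-hand side (for \<open>x = y\<close>).
\<close>

definition coarse_ricci ::
    "('a::polish_space \<Rightarrow> 'w measure) \<Rightarrow> (real \<Rightarrow> 'w \<Rightarrow> 'a) \<Rightarrow> ereal" where
  "coarse_ricci P X =
     Sup {\<sigma> :: ereal. \<forall>t\<ge>0. \<forall>x y.
            Wass (transition P X t x) (transition P X t y) \<le> exp_ext (- \<sigma> * ereal t) * ennreal (dist x y)}"

end

theory Submission
  imports Defs
begin

text \<open>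
  Let \<open>\<kappa>\<close> be the supremum on the right-hand side and \<open>u t x\<close> the mean of \<open>f (X t)\<close> from \<open>x\<close>, for \<open>f\<close>
  bounded and 1-Lipschitz. By the Markov property \<open>u\<close> solves the backward equation \<open>\<partial>\<^sub>t u = L u\<close>.
  Integrating against a near-optimal coupling in \<open>J\<close>, the function \<open>u t x - u t y\<close> is a
  solution, and \<open>exp (\<kappa> t) d(x, y)\<close> a supersolution, of the same backward equation on pairs. The
  coupling is used at one pair \<open>(x, y)\<close> at a time, so no measurable selection is needed.

  The rates are unbounded, so the comparison is made on the pairs whose coordinates have rate at
  most \<open>n\<close>, with a penalty proportional to the probabilities that the process started in either
  coordinate leaves \<open>{rate \<le> n}\<close> before time \<open>t\<close>. These probabilities are supersolutions as well, and
  they vanish as \<open>n \<rightarrow> \<infinity>\<close> because a step path takes finitely many values on \<open>[0, t]\<close>.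
  Hence \<open>u t\<close> is \<open>exp (\<kappa> t)\<close>-Lipschitz. The same comparison applied to the truncated distance
  to a point shows that \<open>X t\<close> has finite first moment, and Kantorovich duality concludes; the
  latter follows from its finite version, a case of Farkas' lemma, by discretising the space.
\<close>

subsection \<open>Maximum principle\<close>

text \<open>\<open>J\<close> is the least drift of the distance under coupled jumps. A plan between
  \<open>q x\<close> with mass \<open>rate y\<close> added at \<open>x\<close> and
  \<open>q y\<close> with mass \<open>rate x\<close> added at \<open>y\<close> lets one coordinate
  stand still while the other jumps, at total rate \<open>rate x + rate y\<close>. A coupled process
  would need such plans chosen measurably in the pair. Here a plan is only integrated against a
  bounded function of each coordinate and the distance, so everything stays with the two separate
  semigroups. The price is a maximum principle without compactness: the functions are merely
  measurable in the starting point, suprema need not be attained, and time derivatives are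
  controlled at one point at a time. Hence only a bound over the whole space at a fixed time and a
  differential inequality at each point are used. Survival probabilities are known to be monotone in
  time, not continuous, which makes the hypotheses one-sided. First moments matter because duality
  tests bounded functions, and the passage to the transport cost goes through a discretisation error
  that has to be integrable.\<close>

lemma comparison_halving:
  fixes g :: "real \<Rightarrow> real"
  assumes init: "g 0 \<le> 0"
    and left: "\<And>t e. 0 < t \<Longrightarrow> 0 < e \<Longrightarrow> \<forall>\<^sub>F s in at_left t. g t \<le> g s + e"
    and step: "\<And>t e. 0 \<le> t \<Longrightarrow> 0 < e \<Longrightarrow>
      \<forall>\<^sub>F h in at_right 0. g (t + h) \<le> g t + h * (l * (M * exp (2 * c * t) - g t) + e)"
    and l: "0 \<le> l" "l \<le> c" and M: "0 \<le> M" and t: "0 \<le> t"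
  shows "g t \<le> M / 2 * exp (2 * c * t)"
proof -
  \<comment> \<open>The exponent \<open>2 * c\<close> is what gains the factor 1/2: the derivative
    of \<open>b\<close> is \<open>c * M * exp (2 * c * t)\<close>, which covers the whole source
    term \<open>l * M * exp (2 * c * t)\<close>, while of the damping only the sign is used.\<close>
  define b where "b t = M / 2 * exp (2 * c * t)" for t :: real
  have c: "0 \<le> c" using l by linarith
  have b_nonneg: "0 \<le> b t" for t using M by (simp add: b_def)
  have b_conv: "b t + h * (c * (M * exp (2 * c * t))) \<le> b (t + h)" for t h
  proof -
    have "exp (2 * c * t) * (1 + 2 * c * h) \<le> exp (2 * c * t) * exp (2 * c * h)"
      by (intro mult_left_mono) auto
    then have "M / 2 * (exp (2 * c * t) * (1 + 2 * c * h)) \<le> M / 2 * (exp (2 * c * t) * exp (2 * c * h))"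
      using M by (intro mult_left_mono) auto
    then show ?thesis by (simp add: b_def distrib_left exp_add algebra_simps)
  qed
  \<comment> \<open>First-violation argument. The margin \<open>e * (1 + t)\<close> has slope
    \<open>e\<close> and so absorbs the error in \<open>step\<close>. The hypothesis
    \<open>left\<close> excludes a violation at the infimum \<open>t0\<close> itself, and
    \<open>step\<close> excludes one shortly after it.\<close>
  have main: "g t \<le> b t + e * (1 + t)" if e: "0 < e" for e
  proof (rule ccontr)
    assume neg: "\<not> ?thesis"
    define A where "A = {s. 0 \<le> s \<and> b s + e * (1 + s) < g s}"
    have A: "t \<in> A" using neg t by (auto simp: A_def)
    have bdd: "bdd_below A" by (auto simp: A_def intro!: bdd_belowI[of _ 0])
    define t0 where "t0 = Inf A"
    have t0: "0 \<le> t0" unfolding t0_def using A by (intro cInf_greatest) (auto simp: A_def)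
    have before: "g s \<le> b s + e * (1 + s)" if "0 \<le> s" "s < t0" for s
      using cInf_lower[OF _ bdd, of s] that unfolding t0_def[symmetric] by (force simp: A_def)
    have at: "g t0 \<le> b t0 + e * (1 + t0)"
    proof (cases "t0 = 0")
      case True
      then show ?thesis using init b_nonneg[of 0] e by simp
    next
      case False
      then have pos: "0 < t0" using t0 by simp
      show ?thesis
      proof (rule field_le_epsilon)
        fix d :: real assume d: "0 < d"
        have lim: "((\<lambda>s. b s + e * (1 + s) + d) \<longlongrightarrow> b t0 + e * (1 + t0) + d) (at_left t0)"
          unfolding b_def by (intro tendsto_intros)
        have ev: "\<forall>\<^sub>F s in at_left t0. g t0 \<le> b s + e * (1 + s) + d"
          using left[OF pos d] eventually_at_left_real[OF pos]
        proof eventually_elim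
          case (elim s)
          then show ?case using before[of s] by auto
        qed
        show "g t0 \<le> b t0 + e * (1 + t0) + d"
          by (rule tendsto_lowerbound[OF lim ev]) simp
      qed
    qed
    let ?y = "b t0 + e * (1 + t0)"
    have y: "0 \<le> ?y" using b_nonneg[of t0] e t0 by (auto intro!: add_nonneg_nonneg mult_nonneg_nonneg)
    have "((\<lambda>h. h * l) \<longlongrightarrow> 0 * l) (at_right 0)" by (intro tendsto_intros)
    \<comment> \<open>For \<open>h * l < 1\<close> the factor \<open>1 - h * l\<close> is positive,
      so the bound on \<open>g t0\<close> can be multiplied by it.\<close>
    then have small: "\<forall>\<^sub>F h in at_right 0. h * l < 1"
      by (rule order_tendstoD) simp
    have "\<forall>\<^sub>F h in at_right 0. g (t0 + h) \<le> b (t0 + h) + e * (1 + (t0 + h))"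
      using step[OF t0 e] small eventually_at_right_less
    proof eventually_elim
      case (elim h)
      have "g (t0 + h) \<le> g t0 * (1 - h * l) + h * (l * (M * exp (2 * c * t0))) + h * e"
        using elim(1) by (simp add: algebra_simps)
      also have "g t0 * (1 - h * l) \<le> ?y * (1 - h * l)"
        using at elim(2) by (intro mult_right_mono) auto
      also have "\<dots> \<le> ?y"
        using y l elim(3) by (simp add: mult_left_le)
      also have "h * (l * (M * exp (2 * c * t0))) \<le> h * (c * (M * exp (2 * c * t0)))"
        using l M elim(3) by (intro mult_left_mono mult_right_mono) auto
      finally show ?case using b_conv[of t0 h] by (simp add: algebra_simps)
    qed
    then obtain d where d: "0 < d" "\<And>h. 0 < h \<Longrightarrow> h < d \<Longrightarrow> g (t0 + h) \<le> b (t0 + h) + e * (1 + (t0 + h))"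
      unfolding eventually_at_right_field by auto
    have "t0 + d \<le> Inf A"
    proof (rule cInf_greatest)
      fix s assume s: "s \<in> A"
      then have "t0 \<le> s" unfolding t0_def by (rule cInf_lower[OF _ bdd])
      then show "t0 + d \<le> s"
        using s at d(2)[of "s - t0"] by (force simp: A_def)
    qed (use A in auto)
    then show False using d(1) by (simp add: t0_def)
  qed
  have "g t \<le> b t"
  proof (rule field_le_epsilon)
    fix d :: real assume "0 < d"
    then show "g t \<le> b t + d" using main[of "d / (1 + t)"] t by auto
  qed
  then show ?thesis by (simp add: b_def)
qed

text \<open>A bound \<open>M * exp (2 * c * t)\<close> valid at all points is halved by
  \<open>comparison_halving\<close>, one point at a time; iterating from
  \<open>M = \<bar>B\<bar>\<close> drives it to 0. This replaces the usual argument at a maximum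
  point, which may not exist on a noncompact space. The common bound \<open>c\<close> on the rates
  over \<open>D\<close> lets one exponent serve all points.\<close>

lemma maximum_principle:
  fixes g :: "real \<Rightarrow> 'z \<Rightarrow> real" and l :: "'z \<Rightarrow> real"
  assumes bound: "\<And>t z. 0 \<le> t \<Longrightarrow> g t z \<le> B"
    and off: "\<And>t z. 0 \<le> t \<Longrightarrow> z \<notin> D \<Longrightarrow> g t z \<le> 0"
    and init: "\<And>z. z \<in> D \<Longrightarrow> g 0 z \<le> 0"
    and left: "\<And>z t e. z \<in> D \<Longrightarrow> 0 < t \<Longrightarrow> 0 < e \<Longrightarrow> \<forall>\<^sub>F s in at_left t. g t z \<le> g s z + e"
    and step: "\<And>z t M e. z \<in> D \<Longrightarrow> 0 \<le> t \<Longrightarrow> 0 \<le> M \<Longrightarrow> (\<And>z'. g t z' \<le> M) \<Longrightarrow> 0 < e \<Longrightarrow>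
      \<forall>\<^sub>F h in at_right 0. g (t + h) z \<le> g t z + h * (l z * (M - g t z) + e)"
    and l: "\<And>z. z \<in> D \<Longrightarrow> 0 \<le> l z" "\<And>z. z \<in> D \<Longrightarrow> l z \<le> c"
    and t: "0 \<le> t"
  shows "g t z \<le> 0"
proof -
  have c: "0 \<le> c" if "z \<in> D" for z using l[OF that] by linarith
  have iter: "g t z \<le> \<bar>B\<bar> * (1 / 2) ^ k * exp (2 * c * t)" if "0 \<le> t" "D \<noteq> {}" for k t z
    using that(1)
  proof (induction k arbitrary: t z)
    case 0
    have "0 \<le> c" using c that(2) by auto
    then have "1 \<le> exp (2 * c * t)" using 0 by simp
    then have "\<bar>B\<bar> * 1 \<le> \<bar>B\<bar> * exp (2 * c * t)" by (intro mult_left_mono) auto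
    then show ?case using bound[OF 0, of z] by simp
  next
    case (Suc k)
    show ?case
    proof (cases "z \<in> D")
      case False
      have "0 \<le> \<bar>B\<bar> * (1 / 2) ^ Suc k * exp (2 * c * t)" by simp
      then show ?thesis using off[OF Suc.prems False] by linarith
    next
      case True
      have "g t z \<le> (\<bar>B\<bar> * (1 / 2) ^ k) / 2 * exp (2 * c * t)"
      proof (rule comparison_halving[where g = "\<lambda>t. g t z" and l = "l z"])
        fix s e :: real assume "0 \<le> s" "0 < e"
        then show "\<forall>\<^sub>F h in at_right 0. g (s + h) z
            \<le> g s z + h * (l z * (\<bar>B\<bar> * (1 / 2) ^ k * exp (2 * c * s) - g s z) + e)"
          using Suc.IH by (intro step[OF True]) auto
      qed (use True init left l Suc.prems in auto)
      then show ?thesis by simp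
    qed
  qed
  show ?thesis
  proof (cases "z \<in> D")
    case True
    have "(\<lambda>k. \<bar>B\<bar> * (1 / 2) ^ k * exp (2 * c * t)) \<longlonglongrightarrow> \<bar>B\<bar> * 0 * exp (2 * c * t)"
      by (intro tendsto_intros LIMSEQ_realpow_zero) auto
    then have "g t z \<le> \<bar>B\<bar> * 0 * exp (2 * c * t)"
      by (rule LIMSEQ_le_const) (use True iter[OF t] in blast)
    then show ?thesis by simp
  qed (use off t in auto)
qed

subsection \<open>Kantorovich duality\<close>

definition linear_form :: "(('i \<Rightarrow> real) \<Rightarrow> real) \<Rightarrow> bool" where
  "linear_form \<alpha> \<longleftrightarrow> (\<forall>x y c. \<alpha> (\<lambda>i. x i + c * y i) = \<alpha> x + c * \<alpha> y)"

lemma linear_formD: "linear_form \<alpha> \<Longrightarrow> \<alpha> (\<lambda>i. x i + c * y i) = \<alpha> x + c * \<alpha> y"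
  by (simp add: linear_form_def)

lemma linear_form_scale:
  assumes "linear_form \<alpha>"
  shows "\<alpha> (\<lambda>i. c * y i) = c * \<alpha> y"
proof -
  have "\<alpha> (\<lambda>i. 0 + 1 * 0) = \<alpha> (\<lambda>i. 0) + 1 * \<alpha> (\<lambda>i. 0)"
    using linear_formD[OF assms, of "\<lambda>i. 0" 1 "\<lambda>i. 0"] by simp
  then have "\<alpha> (\<lambda>i. 0) = 0" by simp
  then show ?thesis
    using linear_formD[OF assms, of "\<lambda>i. 0" c y] by simp
qed

text \<open>Bartl's induction: if the form \<open>A k\<^sub>0\<close> is really needed, there is \<open>x\<^sub>0\<close> violating the
  implication without it, and projecting along \<open>x\<^sub>0\<close> onto the kernel of \<open>A k\<^sub>0\<close> removes \<open>k\<^sub>0\<close>.\<close>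

lemma Farkas_linear_form:
  assumes "finite K" "linear_form \<gamma>" "\<And>k. k \<in> K \<Longrightarrow> linear_form (A k)"
    and "\<And>x. (\<And>k. k \<in> K \<Longrightarrow> A k x \<le> 0) \<Longrightarrow> \<gamma> x \<le> 0"
  shows "\<exists>l. (\<forall>k\<in>K. 0 \<le> l k) \<and> (\<forall>x. \<gamma> x = (\<Sum>k\<in>K. l k * A k x))"
  using assms
proof (induction K arbitrary: \<gamma> A rule: finite_induct)
  case empty
  have "\<gamma> x = 0" for x
    using empty.prems(3)[of x] empty.prems(3)[of "\<lambda>i. (-1) * x i"]
      linear_form_scale[OF empty.prems(1), of "-1" x] by simp
  then show ?case by simp
next
  case (insert k0 K)
  show ?case
  proof (cases "\<forall>x. (\<forall>k\<in>K. A k x \<le> 0) \<longrightarrow> \<gamma> x \<le> 0")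
    case True
    obtain l where l: "\<forall>k\<in>K. 0 \<le> l k" "\<forall>x. \<gamma> x = (\<Sum>k\<in>K. l k * A k x)"
      using insert.IH[of \<gamma> A] insert.prems True by auto
    have "\<gamma> x = (\<Sum>k\<in>insert k0 K. (l(k0 := 0)) k * A k x)" for x
    proof -
      have "(\<Sum>k\<in>K. (l(k0 := 0)) k * A k x) = (\<Sum>k\<in>K. l k * A k x)"
        using insert.hyps by (intro sum.cong) auto
      then show ?thesis using l(2) insert.hyps by simp
    qed
    then show ?thesis using l(1) by (intro exI[of _ "l(k0 := 0)"]) auto
  next
    case False
    then obtain x1 where x1: "\<And>k. k \<in> K \<Longrightarrow> A k x1 \<le> 0" "0 < \<gamma> x1" by force
    have lin: "linear_form (A k)" if "k \<in> insert k0 K" for k using insert.prems(2) that by auto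
    have pos: "0 < A k0 x1" using insert.prems(3)[of x1] x1 by force
    define x0 where "x0 = (\<lambda>i. (1 / A k0 x1) * x1 i)"
    have x0_eq: "\<alpha> x0 = \<alpha> x1 / A k0 x1" if "linear_form \<alpha>" for \<alpha>
      using linear_form_scale[OF that, of "1 / A k0 x1" x1] by (simp add: x0_def)
    have x0: "A k x0 \<le> 0" if "k \<in> K" for k
      using x0_eq[OF lin, of k] x1(1)[OF that] pos that by (simp add: divide_nonpos_pos)
    have x0': "A k0 x0 = 1" "0 < \<gamma> x0"
      using x0_eq[OF lin, of k0] x0_eq[OF insert.prems(1)] x1 pos by auto
    define pr where "pr x = (\<lambda>i. x i + (- A k0 x) * x0 i)" for x
    have pr: "\<alpha> (pr x) = \<alpha> x - A k0 x * \<alpha> x0" if "linear_form \<alpha>" for \<alpha> x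
      using linear_formD[OF that, of x "- A k0 x" x0] by (simp add: pr_def)
    have lin_pr: "linear_form (\<lambda>x. \<alpha> (pr x))" if "linear_form \<alpha>" for \<alpha>
      unfolding linear_form_def pr[OF that]
      by (simp add: linear_formD[OF that] linear_formD[OF lin[of k0]] algebra_simps)
    have "\<gamma> (pr x) \<le> 0" if "\<And>k. k \<in> K \<Longrightarrow> A k (pr x) \<le> 0" for x
    proof (rule insert.prems(3))
      fix k assume "k \<in> insert k0 K"
      then show "A k (pr x) \<le> 0" using that pr[OF lin[of k0], of x] x0' by auto
    qed
    then obtain l where l: "\<forall>k\<in>K. 0 \<le> l k" "\<forall>x. \<gamma> (pr x) = (\<Sum>k\<in>K. l k * A k (pr x))"
      using insert.IH[of "\<lambda>x. \<gamma> (pr x)" "\<lambda>k x. A k (pr x)"] lin_pr insert.prems(1) lin by auto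
    \<comment> \<open>Expanding \<open>pr x\<close> in the identity for \<open>K\<close> leaves a
      multiple of \<open>A k0 x\<close>; its coefficient becomes the multiplier of
      \<open>k0\<close>. It is nonnegative because \<open>0 < \<gamma> x0\<close> and
      \<open>A k x0 \<le> 0\<close> on \<open>K\<close>.\<close>
    define m where "m = l(k0 := \<gamma> x0 - (\<Sum>k\<in>K. l k * A k x0))"
    have m_K: "m k = l k" if "k \<in> K" for k using that insert.hyps by (auto simp: m_def)
    have "(\<Sum>k\<in>K. l k * A k x0) \<le> 0"
      using l(1) x0 by (intro sum_nonpos mult_nonneg_nonpos) auto
    then have nonneg: "\<forall>k\<in>insert k0 K. 0 \<le> m k"
      using l(1) x0' by (auto simp: m_def)
    have "\<gamma> x = (\<Sum>k\<in>insert k0 K. m k * A k x)" for x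
    proof -
      have "\<gamma> x - A k0 x * \<gamma> x0 = (\<Sum>k\<in>K. l k * (A k x - A k0 x * A k x0))"
        using l(2)[rule_format, of x] lin by (simp add: pr insert.prems(1))
      also have "\<dots> = (\<Sum>k\<in>K. l k * A k x) - A k0 x * (\<Sum>k\<in>K. l k * A k x0)"
        by (simp add: algebra_simps sum_subtractf sum_distrib_left)
      finally have "\<gamma> x = (\<Sum>k\<in>K. l k * A k x) + m k0 * A k0 x"
        by (simp add: m_def algebra_simps)
      also have "(\<Sum>k\<in>K. l k * A k x) = (\<Sum>k\<in>K. m k * A k x)"
        using m_K by simp
      finally show ?thesis using insert.hyps by simp
    qed
    then show ?thesis using nonneg by blast
  qed
qed

text \<open>Linear programming duality. Farkas' lemma is applied to vectors \<open>z\<close> made of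
  a potential on each of two copies of \<open>S\<close> and a multiplier \<open>- z None\<close> for
  the cost. The multipliers of the pair constraints form the plan, and that of \<open>None\<close>
  is the slack in the cost bound. Test functions live on the whole type, hence the extension of a
  potential from \<open>S\<close> in the proof.\<close>

lemma finite_Kantorovich_duality:
  fixes S :: "'a::metric_space set" and p q :: "'a \<Rightarrow> real"
  assumes S: "finite S" "S \<noteq> {}" and p: "\<And>x. x \<in> S \<Longrightarrow> 0 \<le> p x" and q: "\<And>x. x \<in> S \<Longrightarrow> 0 \<le> q x"
    and D: "\<And>f. bounded (range f) \<Longrightarrow> (\<And>x y. \<bar>f x - f y\<bar> \<le> dist x y) \<Longrightarrow>
      (\<Sum>x\<in>S. f x * p x) - (\<Sum>x\<in>S. f x * q x) \<le> D"
  shows "\<exists>w. (\<forall>x\<in>S. \<forall>y\<in>S. 0 \<le> w x y) \<and> (\<forall>x\<in>S. (\<Sum>y\<in>S. w x y) = p x) \<and>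
    (\<forall>y\<in>S. (\<Sum>x\<in>S. w x y) = q y) \<and> (\<Sum>x\<in>S. \<Sum>y\<in>S. w x y * dist x y) \<le> D"
proof -
  define \<alpha> where "\<alpha> k z = (case k of None \<Rightarrow> z None
      | Some (x, y) \<Rightarrow> z (Some (Inl x)) + z (Some (Inr y)) + dist x y * z None)"
    for k :: "('a \<times> 'a) option" and z :: "('a + 'a) option \<Rightarrow> real"
  define \<gamma> where "\<gamma> z = (\<Sum>x\<in>S. p x * z (Some (Inl x))) + (\<Sum>y\<in>S. q y * z (Some (Inr y))) + D * z None"
    for z :: "('a + 'a) option \<Rightarrow> real"
  define K where "K = insert None (Some ` (S \<times> S))"
  have finK: "finite K" using S by (simp add: K_def)
  have lin\<alpha>: "linear_form (\<alpha> k)" for k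
    by (auto simp: linear_form_def \<alpha>_def algebra_simps split: option.split)
  have lin\<gamma>: "linear_form \<gamma>"
    by (simp add: linear_form_def \<gamma>_def algebra_simps sum.distrib sum_distrib_left)
  have nonpos: "\<gamma> z \<le> 0" if z: "\<And>k. k \<in> K \<Longrightarrow> \<alpha> k z \<le> 0" for z
  proof -
    define t where "t = - z None"
    have t: "0 \<le> t" using z[of None] by (auto simp: K_def \<alpha>_def t_def)
    have le: "z (Some (Inl x)) + z (Some (Inr y)) \<le> t * dist x y" if "x \<in> S" "y \<in> S" for x y
      using z[of "Some (x, y)"] that by (auto simp: K_def \<alpha>_def t_def algebra_simps)
    \<comment> \<open>The transform of the second potential, a minimum of \<open>t\<close>-Lipschitz
      functions. On \<open>S\<close> it dominates the first potential and \<open>- F\<close>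
      dominates the second, so passing to \<open>F\<close> and \<open>- F\<close> only increases the
      sums to be bounded.\<close>
    define F where "F x = Min ((\<lambda>y. t * dist x y - z (Some (Inr y))) ` S)" for x
    have F_le: "F x \<le> t * dist x y - z (Some (Inr y))" if "y \<in> S" for x y
      unfolding F_def using S that by (intro Min_le) auto
    have F_ge: "z (Some (Inl x)) \<le> F x" if "x \<in> S" for x
      unfolding F_def using S le[OF that] by (subst Min_ge_iff) (auto simp: algebra_simps)
    have F_lip1: "F x \<le> F x' + t * dist x x'" for x x'
    proof -
      have "F x - t * dist x x' \<le> t * dist x' y - z (Some (Inr y))" if "y \<in> S" for y
      proof -
        have "t * dist x y \<le> t * (dist x x' + dist x' y)"
          using t by (intro mult_left_mono dist_triangle)
        then show ?thesis using F_le[OF that, of x] by (simp add: algebra_simps)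
      qed
      then have "F x - t * dist x x' \<le> F x'"
        unfolding F_def[of x'] using S by (subst Min_ge_iff) auto
      then show ?thesis by simp
    qed
    define C where "C = (\<Sum>x\<in>S. \<bar>F x\<bar>)"
    have C: "\<bar>F x\<bar> \<le> C" if "x \<in> S" for x
      unfolding C_def using S that by (intro member_le_sum) auto
    have C0: "0 \<le> C" by (simp add: C_def sum_nonneg)
    \<comment> \<open>Truncation at \<open>C\<close> keeps the values on \<open>S\<close> and yields
      the bounded function that \<open>D\<close> demands.\<close>
    define G where "G x = max (- C) (min C (F x))" for x
    have G_eq: "G x = F x" if "x \<in> S" for x using C[OF that] by (auto simp: G_def)
    have G_bdd: "\<bar>G x\<bar> \<le> C" for x using C0 by (auto simp: G_def)
    have G_lip: "\<bar>G x - G y\<bar> \<le> t * dist x y" for x y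
      using F_lip1[of x y] F_lip1[of y x] t by (auto simp: G_def dist_commute max_def min_def abs_if)
    have fin: "(\<Sum>x\<in>S. G x * p x) - (\<Sum>x\<in>S. G x * q x) \<le> t * D"
    proof (cases "t = 0")
      case True
      \<comment> \<open>For \<open>t = 0\<close> the function \<open>G\<close> is constant. Since
        \<open>D\<close> covers every constant function, the total masses agree, and both sides are
        0.\<close>
      have const: "G x = G y" for x y using G_lip[of x y] True by simp
      have eq: "(\<Sum>x\<in>S. c * p x) - (\<Sum>x\<in>S. c * q x) \<le> D" for c
        by (rule D) auto
      have all: "c * ((\<Sum>x\<in>S. p x) - (\<Sum>x\<in>S. q x)) \<le> D" for c
        using eq[of c] by (simp add: sum_distrib_left[symmetric] algebra_simps)
      have "(\<Sum>x\<in>S. p x) - (\<Sum>x\<in>S. q x) = 0"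
      proof (rule ccontr)
        assume ne: "\<not> ?thesis"
        \<comment> \<open>With this constant the left-hand side of \<open>all\<close> is
          \<open>\<bar>D\<bar> + 1\<close>, which exceeds \<open>D\<close>.\<close>
        show False using all[of "(\<bar>D\<bar> + 1) / ((\<Sum>x\<in>S. p x) - (\<Sum>x\<in>S. q x))"] ne by simp
      qed
      moreover obtain a where "a \<in> S" using S by auto
      moreover have "(\<Sum>x\<in>S. G x * p x) - (\<Sum>x\<in>S. G x * q x) = G a * ((\<Sum>x\<in>S. p x) - (\<Sum>x\<in>S. q x))"
        unfolding right_diff_distrib sum_distrib_left
        by (intro arg_cong2[of _ _ _ _ minus] sum.cong) (auto intro: const)
      ultimately show ?thesis using True by simp
    next
      case False
      then have tp: "0 < t" using t by simp
      have "(\<Sum>x\<in>S. G x / t * p x) - (\<Sum>x\<in>S. G x / t * q x) \<le> D"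
      proof (rule D)
        show "bounded (range (\<lambda>x. G x / t))"
          using G_bdd tp by (intro boundedI[of _ "C / t"]) (auto simp: divide_right_mono)
        show "\<bar>G x / t - G y / t\<bar> \<le> dist x y" for x y
          using G_lip[of x y] tp by (simp add: diff_divide_distrib[symmetric] divide_le_eq mult.commute)
      qed
      moreover have "(\<Sum>x\<in>S. G x / t * r x) = (\<Sum>x\<in>S. G x * r x) / t" for r
        by (simp add: sum_divide_distrib)
      ultimately have "((\<Sum>x\<in>S. G x * p x) - (\<Sum>x\<in>S. G x * q x)) / t \<le> D"
        by (simp only: diff_divide_distrib)
      then show ?thesis using tp by (simp add: divide_le_eq mult.commute)
    qed
    have "(\<Sum>x\<in>S. p x * z (Some (Inl x))) \<le> (\<Sum>x\<in>S. G x * p x)"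
    proof (rule sum_mono)
      fix x assume x: "x \<in> S"
      have "p x * z (Some (Inl x)) \<le> p x * G x"
        using F_ge[OF x] G_eq[OF x] p[OF x] by (intro mult_left_mono) auto
      then show "p x * z (Some (Inl x)) \<le> G x * p x" by (simp add: mult.commute)
    qed
    moreover have "(\<Sum>x\<in>S. q x * z (Some (Inr x))) \<le> - (\<Sum>x\<in>S. G x * q x)"
      unfolding sum_negf[symmetric]
    proof (rule sum_mono)
      fix x assume x: "x \<in> S"
      have "q x * z (Some (Inr x)) \<le> q x * (- G x)"
        using F_le[OF x, of x] G_eq[OF x] q[OF x] by (intro mult_left_mono) auto
      then show "q x * z (Some (Inr x)) \<le> - (G x * q x)" by (simp add: mult.commute)
    qed
    ultimately show ?thesis using fin by (simp add: \<gamma>_def t_def algebra_simps)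
  qed
  obtain l where l: "\<forall>k\<in>K. 0 \<le> l k" "\<forall>z. \<gamma> z = (\<Sum>k\<in>K. l k * \<alpha> k z)"
    using Farkas_linear_form[OF finK lin\<gamma>, of \<alpha>, OF lin\<alpha> nonpos] by metis
  define w where "w x y = l (Some (x, y))" for x y
  have sumK: "(\<Sum>k\<in>K. l k * \<alpha> k z) = l None * \<alpha> None z + (\<Sum>x\<in>S. \<Sum>y\<in>S. w x y * \<alpha> (Some (x, y)) z)" for z
    using S unfolding K_def w_def
    by (subst sum.insert) (auto simp: sum.reindex sum.cartesian_product case_prod_beta)
  have "(\<Sum>y\<in>S. w a y) = p a" if a: "a \<in> S" for a
  proof -
    \<comment> \<open>Unit vectors read off the coefficients of the identity of linear forms: the
      two marginals at \<open>Inl\<close> and \<open>Inr\<close>, and the cost at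
      \<open>None\<close>.\<close>
    define e where "e k = (if k = Some (Inl a) then 1 else 0 :: real)" for k :: "('a + 'a) option"
    have "\<gamma> e = p a" using a S by (simp add: \<gamma>_def e_def if_distrib sum.delta' cong: if_cong)
    moreover have "(\<Sum>k\<in>K. l k * \<alpha> k e) = (\<Sum>x\<in>S. if x = a then (\<Sum>y\<in>S. w x y) else 0)"
      unfolding sumK by (auto simp: \<alpha>_def e_def intro!: sum.cong)
    ultimately show ?thesis using l(2) a S by simp
  qed
  moreover have "(\<Sum>x\<in>S. w x a) = q a" if a: "a \<in> S" for a
  proof -
    define e where "e k = (if k = Some (Inr a) then 1 else 0 :: real)" for k :: "('a + 'a) option"
    have "\<gamma> e = q a" using a S by (simp add: \<gamma>_def e_def if_distrib sum.delta' cong: if_cong)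
    moreover have "(\<Sum>k\<in>K. l k * \<alpha> k e) = (\<Sum>x\<in>S. \<Sum>y\<in>S. if y = a then w x y else 0)"
      unfolding sumK by (auto simp: \<alpha>_def e_def intro!: sum.cong)
    ultimately show ?thesis using l(2) a S by simp
  qed
  moreover have "(\<Sum>x\<in>S. \<Sum>y\<in>S. w x y * dist x y) \<le> D"
  proof -
    define e where "e k = (if k = None then 1 else 0 :: real)" for k :: "('a + 'a) option"
    have "\<gamma> e = D" by (simp add: \<gamma>_def e_def)
    moreover have "(\<Sum>k\<in>K. l k * \<alpha> k e) = l None + (\<Sum>x\<in>S. \<Sum>y\<in>S. w x y * dist x y)"
      unfolding sumK by (simp add: \<alpha>_def e_def)
    ultimately show ?thesis using l by (simp add: K_def)
  qed
  moreover have "\<forall>x\<in>S. \<forall>y\<in>S. 0 \<le> w x y" using l(1) by (auto simp: K_def w_def)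
  ultimately show ?thesis by blast
qed

section \<open>Bounded measurable functions\<close>

definition bounded_measurable :: "('a::topological_space \<Rightarrow> real) set" where
  "bounded_measurable = {f. f \<in> borel_measurable borel \<and> bounded (range f)}"

lemma bounded_measurableD: "f \<in> bounded_measurable \<Longrightarrow> f \<in> borel_measurable borel"
  by (simp add: bounded_measurable_def)

lemma bounded_measurableI: "f \<in> borel_measurable borel \<Longrightarrow> (\<And>x. \<bar>f x\<bar> \<le> B) \<Longrightarrow> f \<in> bounded_measurable"
  by (auto simp: bounded_measurable_def intro!: boundedI)

lemma bounded_measurable_obtain_bound:
  assumes "f \<in> bounded_measurable"
  obtains B where "0 \<le> B" "\<And>x. \<bar>f x\<bar> \<le> B"
proof -
  obtain B where "\<And>x. \<bar>f x\<bar> \<le> B" using assms by (auto simp: bounded_measurable_def bounded_iff)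
  moreover from this[of undefined] have "0 \<le> B" by linarith
  ultimately show ?thesis using that by blast
qed

lemma bounded_measurable_lincomb:
  assumes "f \<in> bounded_measurable" "g \<in> bounded_measurable"
  shows "(\<lambda>x. a * f x + b * g x) \<in> bounded_measurable"
proof -
  obtain B C where B: "\<And>x. \<bar>f x\<bar> \<le> B" and C: "\<And>x. \<bar>g x\<bar> \<le> C"
    using assms by (metis bounded_measurable_obtain_bound)
  have [measurable]: "f \<in> borel_measurable borel" "g \<in> borel_measurable borel"
    using assms by (auto dest: bounded_measurableD)
  show ?thesis
  proof (rule bounded_measurableI)
    show "\<bar>a * f x + b * g x\<bar> \<le> \<bar>a\<bar> * B + \<bar>b\<bar> * C" for x
    proof -
      have "\<bar>a * f x + b * g x\<bar> \<le> \<bar>a\<bar> * \<bar>f x\<bar> + \<bar>b\<bar> * \<bar>g x\<bar>"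
        using abs_triangle_ineq[of "a * f x" "b * g x"] by (simp add: abs_mult)
      also have "\<dots> \<le> \<bar>a\<bar> * B + \<bar>b\<bar> * C"
        using B C by (intro add_mono mult_left_mono) auto
      finally show ?thesis .
    qed
  qed simp
qed

lemma bounded_measurable_const: "(\<lambda>x. c) \<in> bounded_measurable"
  by (rule bounded_measurableI[of _ "\<bar>c\<bar>"]) auto

lemma bounded_measurable_indicator: "A \<in> sets borel \<Longrightarrow> indicator A \<in> bounded_measurable"
  by (rule bounded_measurableI[of _ 1]) auto

lemma bounded_measurable_times:
  assumes "f \<in> bounded_measurable" "g \<in> bounded_measurable"
  shows "(\<lambda>x. f x * g x) \<in> bounded_measurable"
proof -
  obtain B C where B: "0 \<le> B" "\<And>x. \<bar>f x\<bar> \<le> B" and C: "\<And>x. \<bar>g x\<bar> \<le> C"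
    using assms by (metis bounded_measurable_obtain_bound)
  have [measurable]: "f \<in> borel_measurable borel" "g \<in> borel_measurable borel"
    using assms by (auto dest: bounded_measurableD)
  show ?thesis
    by (rule bounded_measurableI[of _ "B * C"]) (use B C in \<open>auto simp: abs_mult intro: mult_mono\<close>)
qed

lemma integrable_bounded_measurable:
  assumes "finite_measure M" "sets M = sets borel" "f \<in> bounded_measurable"
  shows "integrable M f"
proof -
  interpret finite_measure M by fact
  have [measurable]: "f \<in> borel_measurable M"
    using assms(2,3) measurable_cong_sets[OF assms(2) refl] by (auto dest: bounded_measurableD)
  obtain B where "\<And>x. \<bar>f x\<bar> \<le> B" using bounded_measurable_obtain_bound[OF assms(3)] by blast
  then show ?thesis by (intro integrable_const_bound[of _ B]) auto
qed

lemma Lipschitz_bounded_measurable: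
  fixes f :: "'a::metric_space \<Rightarrow> real"
  assumes "bounded (range f)" and f: "\<And>x y. \<bar>f x - f y\<bar> \<le> dist x y"
  shows "f \<in> bounded_measurable"
proof -
  have "continuous_on UNIV f"
  proof (rule continuous_onI)
    fix x and e :: real assume "0 < e"
    then show "\<exists>d>0. \<forall>x'\<in>UNIV. dist x' x < d \<longrightarrow> dist (f x') (f x) \<le> e"
      by (intro exI[of _ e]) (auto simp: dist_real_def intro: order_trans[OF f])
  qed
  then show ?thesis using assms(1) by (simp add: bounded_measurable_def borel_measurable_continuous_onI)
qed

section \<open>Lifting discrete plans to couplings\<close>

lemma nn_integral_finite_range:
  fixes T :: "'a \<Rightarrow> 'b" and F :: "'b \<Rightarrow> ennreal"
  assumes S: "finite S" "range T \<subseteq> S" and M: "space M = UNIV" "\<And>a. a \<in> S \<Longrightarrow> T -` {a} \<in> sets M"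
  shows "(\<integral>\<^sup>+x. F (T x) \<partial>M) = (\<Sum>a\<in>S. F a * emeasure M (T -` {a}))"
proof -
  have "F (T x) = (\<Sum>a\<in>S. F a * indicator (T -` {a}) x)" for x
  proof -
    have "(\<Sum>a\<in>S. F a * indicator (T -` {a}) x) = (\<Sum>a\<in>S. if a = T x then F a else 0)"
      by (intro sum.cong) (auto simp: indicator_def)
    then show ?thesis using S by auto
  qed
  then have "(\<integral>\<^sup>+x. F (T x) \<partial>M) = (\<integral>\<^sup>+x. (\<Sum>a\<in>S. F a * indicator (T -` {a}) x) \<partial>M)"
    by simp
  also have "\<dots> = (\<Sum>a\<in>S. F a * emeasure M (T -` {a}))"
    using M by (subst nn_integral_sum) (auto simp: nn_integral_cmult)
  finally show ?thesis .
qed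

text \<open>There are finitely many cells, so those of mass zero have a null union. A density
  obtained by dividing by cell masses thus has to be right only on cells of positive mass.\<close>

lemma AE_finite_range_pos:
  assumes S: "finite S" "range T \<subseteq> S" and M: "space M = UNIV" "\<And>a. a \<in> S \<Longrightarrow> T -` {a} \<in> sets M"
    "finite_measure M"
  shows "AE x in M. measure M (T -` {T x}) \<noteq> 0"
proof -
  interpret finite_measure M by fact
  have "AE x in M. \<forall>a\<in>S. measure M (T -` {a}) = 0 \<longrightarrow> x \<notin> T -` {a}"
  proof (rule AE_finite_allI[OF S(1)])
    fix a assume a: "a \<in> S"
    show "AE x in M. measure M (T -` {a}) = 0 \<longrightarrow> x \<notin> T -` {a}"
    proof (cases "measure M (T -` {a}) = 0")
      case True
      then have "T -` {a} \<in> null_sets M" using M(2)[OF a] by (simp add: null_sets_def emeasure_eq_measure)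
      then show ?thesis by (auto dest: AE_not_in)
    qed simp
  qed
  then show ?thesis by eventually_elim (use S in auto)
qed

lemma space_eq_UNIV: "sets M = sets borel \<Longrightarrow> space M = UNIV"
  using sets_eq_imp_space_eq[of M borel] by simp

text \<open>Tonelli: integrating out the second variable leaves the factor 1 almost
  everywhere.\<close>

lemma marginal_of_density:
  fixes \<mu> \<nu> :: "'a::second_countable_topology measure"
  assumes sets: "sets \<mu> = sets borel" "sets \<nu> = sets borel" and "sigma_finite_measure \<nu>"
    and k: "k \<in> borel_measurable (borel \<Otimes>\<^sub>M borel)" and one: "AE x in \<mu>. (\<integral>\<^sup>+y. k (x, y) \<partial>\<nu>) = 1"
  shows "distr (density (\<mu> \<Otimes>\<^sub>M \<nu>) k) borel fst = \<mu>"
proof (rule measure_eqI)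
  interpret sigma_finite_measure \<nu> by fact
  have [measurable_cong]: "sets \<mu> = sets borel" "sets \<nu> = sets borel" by fact+
  note k[measurable]
  fix A assume "A \<in> sets (distr (density (\<mu> \<Otimes>\<^sub>M \<nu>) k) borel fst)"
  then have A[measurable]: "A \<in> sets borel" by simp
  have "emeasure (distr (density (\<mu> \<Otimes>\<^sub>M \<nu>) k) borel fst) A
      = (\<integral>\<^sup>+p. k p * indicator A (fst p) \<partial>(\<mu> \<Otimes>\<^sub>M \<nu>))"
    by (subst emeasure_distr, simp, simp, subst emeasure_density, simp, measurable)
       (auto intro!: nn_integral_cong simp: indicator_def)
  also have "\<dots> = (\<integral>\<^sup>+x. \<integral>\<^sup>+y. k (x, y) * indicator A x \<partial>\<nu> \<partial>\<mu>)"
    by (subst nn_integral_fst[symmetric]) auto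
  also have "\<dots> = (\<integral>\<^sup>+x. (\<integral>\<^sup>+y. k (x, y) \<partial>\<nu>) * indicator A x \<partial>\<mu>)"
    by (intro nn_integral_cong nn_integral_multc) simp
  also have "\<dots> = (\<integral>\<^sup>+x. indicator A x \<partial>\<mu>)"
    using one by (intro nn_integral_cong_AE) (auto elim: eventually_mono)
  finally show "emeasure (distr (density (\<mu> \<Otimes>\<^sub>M \<nu>) k) borel fst) A = emeasure \<mu> A"
    using sets by simp
qed (use sets in simp)

lemma marginal_of_density_snd:
  fixes \<mu> \<nu> :: "'a::second_countable_topology measure"
  assumes sets: "sets \<mu> = sets borel" "sets \<nu> = sets borel" and "sigma_finite_measure \<mu>" "sigma_finite_measure \<nu>"
    and k: "k \<in> borel_measurable (borel \<Otimes>\<^sub>M borel)" and one: "AE y in \<nu>. (\<integral>\<^sup>+x. k (x, y) \<partial>\<mu>) = 1"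
  shows "distr (density (\<mu> \<Otimes>\<^sub>M \<nu>) k) borel snd = \<nu>"
proof (rule measure_eqI)
  interpret pair_sigma_finite \<mu> \<nu> using assms(3,4) by (simp add: pair_sigma_finite_def)
  have [measurable_cong]: "sets \<mu> = sets borel" "sets \<nu> = sets borel" by fact+
  note k[measurable]
  fix A assume "A \<in> sets (distr (density (\<mu> \<Otimes>\<^sub>M \<nu>) k) borel snd)"
  then have A[measurable]: "A \<in> sets borel" by simp
  have "emeasure (distr (density (\<mu> \<Otimes>\<^sub>M \<nu>) k) borel snd) A
      = (\<integral>\<^sup>+p. k p * indicator A (snd p) \<partial>(\<mu> \<Otimes>\<^sub>M \<nu>))"
    by (subst emeasure_distr, simp, simp, subst emeasure_density, simp, measurable)
       (auto intro!: nn_integral_cong simp: indicator_def)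
  also have "\<dots> = (\<integral>\<^sup>+y. \<integral>\<^sup>+x. k (x, y) * indicator A y \<partial>\<mu> \<partial>\<nu>)"
    by (subst nn_integral_snd[symmetric]) auto
  also have "\<dots> = (\<integral>\<^sup>+y. (\<integral>\<^sup>+x. k (x, y) \<partial>\<mu>) * indicator A y \<partial>\<nu>)"
    by (intro nn_integral_cong nn_integral_multc) simp
  also have "\<dots> = (\<integral>\<^sup>+y. indicator A y \<partial>\<nu>)"
    using one by (intro nn_integral_cong_AE) (auto elim: eventually_mono)
  finally show "emeasure (distr (density (\<mu> \<Otimes>\<^sub>M \<nu>) k) borel snd) A = emeasure \<nu> A"
    using sets by simp
qed (use sets in simp)

lemma nn_integral_coupling:
  assumes \<pi>: "\<pi> \<in> couplings \<mu> \<nu>" and f: "f \<in> borel_measurable borel"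
  shows "(\<integral>\<^sup>+p. f (fst p) \<partial>\<pi>) = (\<integral>\<^sup>+x. f x \<partial>\<mu>)" "(\<integral>\<^sup>+p. f (snd p) \<partial>\<pi>) = (\<integral>\<^sup>+x. f x \<partial>\<nu>)"
proof -
  have [measurable_cong]: "sets \<pi> = sets (borel \<Otimes>\<^sub>M borel)" and m: "\<mu> = distr \<pi> borel fst" "\<nu> = distr \<pi> borel snd"
    using \<pi> by (auto simp: couplings_def)
  note f[measurable]
  show "(\<integral>\<^sup>+p. f (fst p) \<partial>\<pi>) = (\<integral>\<^sup>+x. f x \<partial>\<mu>)" "(\<integral>\<^sup>+p. f (snd p) \<partial>\<pi>) = (\<integral>\<^sup>+x. f x \<partial>\<nu>)"
    unfolding m by (subst nn_integral_distr; simp)+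
qed

text \<open>A plan \<open>w\<close> between the images under \<open>T\<close> is lifted by spreading \<open>w a b\<close> over
  \<open>T -` {a} \<times> T -` {b}\<close> proportionally to \<open>\<mu> \<Otimes> \<nu>\<close>; no gluing of couplings is needed.\<close>

lemma Wass_le_discretised:
  fixes \<mu> \<nu> :: "'a::polish_space measure" and T :: "'a \<Rightarrow> 'a"
  assumes \<mu>: "prob_space \<mu>" "sets \<mu> = sets borel" and \<nu>: "prob_space \<nu>" "sets \<nu> = sets borel"
    and T: "T \<in> borel \<rightarrow>\<^sub>M borel" and S: "finite S" "range T \<subseteq> S"
    and w: "\<And>x y. x \<in> S \<Longrightarrow> y \<in> S \<Longrightarrow> 0 \<le> w x y"
    and w1: "\<And>x. x \<in> S \<Longrightarrow> (\<Sum>y\<in>S. w x y) = measure \<mu> (T -` {x})"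
    and w2: "\<And>y. y \<in> S \<Longrightarrow> (\<Sum>x\<in>S. w x y) = measure \<nu> (T -` {y})"
  shows "Wass \<mu> \<nu> \<le> (\<integral>\<^sup>+x. dist x (T x) \<partial>\<mu>) + ennreal (\<Sum>x\<in>S. \<Sum>y\<in>S. w x y * dist x y)
    + (\<integral>\<^sup>+x. dist x (T x) \<partial>\<nu>)"
proof -
  interpret \<mu>: prob_space \<mu> by fact
  interpret \<nu>: prob_space \<nu> by fact
  have [measurable_cong]: "sets \<mu> = sets borel" "sets \<nu> = sets borel" by fact+
  note T[measurable]
  define p where "p a = measure \<mu> (T -` {a})" for a
  define q where "q a = measure \<nu> (T -` {a})" for a
  have p: "0 \<le> p a" "emeasure \<mu> (T -` {a}) = ennreal (p a)" for a
    by (simp_all add: p_def \<mu>.emeasure_eq_measure)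
  have q: "0 \<le> q a" "emeasure \<nu> (T -` {a}) = ennreal (q a)" for a
    by (simp_all add: q_def \<nu>.emeasure_eq_measure)
  have vimage[measurable]: "T -` {a} \<in> sets borel" for a
    using measurable_sets[OF T, of "{a}"] by simp
  \<comment> \<open>A cell of mass zero carries no part of the plan, so the value 0 that division by
    0 gives to \<open>h\<close> there is consistent with \<open>w\<close>.\<close>
  have w_p: "w a b = 0" if "p a = 0" "a \<in> S" "b \<in> S" for a b
    using w1[OF that(2)] that sum_nonneg_eq_0_iff[OF S(1), of "\<lambda>b. w a b"] w by (auto simp: p_def)
  have w_q: "w a b = 0" if "q b = 0" "a \<in> S" "b \<in> S" for a b
    using w2[OF that(3)] that sum_nonneg_eq_0_iff[OF S(1), of "\<lambda>a. w a b"] w by (auto simp: q_def)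
  define h where "h a b = w a b / (p a * q b)" for a b
  have h: "0 \<le> h a b" if "a \<in> S" "b \<in> S" for a b using w[OF that] p q by (simp add: h_def)
  define k where "k z = ennreal (h (T (fst z)) (T (snd z)))" for z
  have TS: "T x \<in> S" for x using S by auto
  \<comment> \<open>Written as a finite sum over rectangles of cells, the density is visibly
    measurable, although \<open>h\<close> is arbitrary on \<open>S\<close>.\<close>
  have k_eq: "k = (\<lambda>z. \<Sum>a\<in>S. \<Sum>b\<in>S. ennreal (h a b) * indicator (T -` {a}) (fst z) * indicator (T -` {b}) (snd z))"
  proof
    fix z
    have "(\<Sum>a\<in>S. \<Sum>b\<in>S. ennreal (h a b) * indicator (T -` {a}) (fst z) * indicator (T -` {b}) (snd z))
       = (\<Sum>a\<in>S. if a = T (fst z) then (\<Sum>b\<in>S. if b = T (snd z) then ennreal (h a b) else 0) else 0)"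
      by (intro sum.cong) (auto simp: indicator_def intro!: sum.cong)
    then show "k z = (\<Sum>a\<in>S. \<Sum>b\<in>S. ennreal (h a b) * indicator (T -` {a}) (fst z) * indicator (T -` {b}) (snd z))"
      using S TS by (simp add: k_def)
  qed
  have k[measurable]: "k \<in> borel_measurable (borel \<Otimes>\<^sub>M borel)"
    unfolding k_eq by measurable
  have sp: "space \<mu> = UNIV" "space \<nu> = UNIV" by (simp_all add: space_eq_UNIV[OF \<mu>(2)] space_eq_UNIV[OF \<nu>(2)])
  have int_\<mu>: "(\<integral>\<^sup>+x. F (T x) \<partial>\<mu>) = (\<Sum>a\<in>S. F a * ennreal (p a))" for F
    using S sp \<mu> by (subst nn_integral_finite_range[of S]) (auto simp: p)
  have int_\<nu>: "(\<integral>\<^sup>+x. F (T x) \<partial>\<nu>) = (\<Sum>a\<in>S. F a * ennreal (q a))" for F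
    using S sp \<nu> by (subst nn_integral_finite_range[of S]) (auto simp: q)
  define \<pi> where "\<pi> = density (\<mu> \<Otimes>\<^sub>M \<nu>) k"
  have one1: "(\<integral>\<^sup>+y. k (x, y) \<partial>\<nu>) = 1" if "p (T x) \<noteq> 0" for x
  proof -
    have "(\<integral>\<^sup>+y. k (x, y) \<partial>\<nu>) = (\<Sum>b\<in>S. ennreal (h (T x) b) * ennreal (q b))"
      unfolding k_def fst_conv snd_conv by (rule int_\<nu>)
    also have "\<dots> = (\<Sum>b\<in>S. ennreal (w (T x) b / p (T x)))"
      using w_q[of _ "T x"] TS h q
      by (intro sum.cong refl) (auto simp: h_def ennreal_mult[symmetric])
    also have "\<dots> = ennreal ((\<Sum>b\<in>S. w (T x) b) / p (T x))"
      using w p TS by (subst sum_ennreal) (auto simp: sum_divide_distrib)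
    also have "\<dots> = 1" using w1[OF TS] that by (simp add: p_def)
    finally show ?thesis .
  qed
  have one2: "(\<integral>\<^sup>+x. k (x, y) \<partial>\<mu>) = 1" if "q (T y) \<noteq> 0" for y
  proof -
    have "(\<integral>\<^sup>+x. k (x, y) \<partial>\<mu>) = (\<Sum>a\<in>S. ennreal (h a (T y)) * ennreal (p a))"
      unfolding k_def fst_conv snd_conv by (rule int_\<mu>)
    also have "\<dots> = (\<Sum>a\<in>S. ennreal (w a (T y) / q (T y)))"
      using w_p[of _ "T y"] TS h p
      by (intro sum.cong refl) (auto simp: h_def ennreal_mult[symmetric])
    also have "\<dots> = ennreal ((\<Sum>a\<in>S. w a (T y)) / q (T y))"
      using w q TS by (subst sum_ennreal) (auto simp: sum_divide_distrib)
    also have "\<dots> = 1" using w2[OF TS] that by (simp add: q_def)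
    finally show ?thesis .
  qed
  have "AE x in \<mu>. p (T x) \<noteq> 0" unfolding p_def
    using S sp \<mu> by (intro AE_finite_range_pos[of S]) (auto intro: \<mu>.finite_measure_axioms)
  then have ae1: "AE x in \<mu>. (\<integral>\<^sup>+y. k (x, y) \<partial>\<nu>) = 1" by eventually_elim (rule one1)
  have "AE x in \<nu>. q (T x) \<noteq> 0" unfolding q_def
    using S sp \<nu> by (intro AE_finite_range_pos[of S]) (auto intro: \<nu>.finite_measure_axioms)
  then have ae2: "AE y in \<nu>. (\<integral>\<^sup>+x. k (x, y) \<partial>\<mu>) = 1" by eventually_elim (rule one2)
  have \<pi>_sets[measurable_cong]: "sets \<pi> = sets (borel \<Otimes>\<^sub>M borel)"
    unfolding \<pi>_def using \<mu> \<nu> by (simp cong: sets_pair_measure_cong)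
  have \<pi>: "\<pi> \<in> couplings \<mu> \<nu>"
    unfolding couplings_def using \<pi>_sets
      marginal_of_density[OF \<mu>(2) \<nu>(2) \<nu>.sigma_finite_measure_axioms k ae1]
      marginal_of_density_snd[OF \<mu>(2) \<nu>(2) \<mu>.sigma_finite_measure_axioms \<nu>.sigma_finite_measure_axioms k ae2]
    by (simp add: \<pi>_def)
  have "(\<integral>\<^sup>+z. ennreal (dist (T (fst z)) (T (snd z))) \<partial>\<pi>)
      = (\<integral>\<^sup>+z. k z * ennreal (dist (T (fst z)) (T (snd z))) \<partial>(\<mu> \<Otimes>\<^sub>M \<nu>))"
    unfolding \<pi>_def by (subst nn_integral_density) auto
  also have "\<dots> = (\<integral>\<^sup>+x. \<integral>\<^sup>+y. k (x, y) * ennreal (dist (T x) (T y)) \<partial>\<nu> \<partial>\<mu>)"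
    by (subst \<nu>.nn_integral_fst[symmetric]) auto
  also have "\<dots> = (\<integral>\<^sup>+x. (\<Sum>b\<in>S. ennreal (h (T x) b) * ennreal (dist (T x) b) * ennreal (q b)) \<partial>\<mu>)"
    by (intro nn_integral_cong)
       (use int_\<nu>[of "\<lambda>b. ennreal (h (T _) b) * ennreal (dist (T _) b)"] in \<open>simp add: k_def\<close>)
  also have "\<dots> = (\<Sum>a\<in>S. (\<Sum>b\<in>S. ennreal (h a b) * ennreal (dist a b) * ennreal (q b)) * ennreal (p a))"
    by (rule int_\<mu>)
  also have "\<dots> = (\<Sum>a\<in>S. \<Sum>b\<in>S. ennreal (w a b * dist a b))"
    unfolding sum_distrib_right
  proof (intro sum.cong refl)
    fix a b assume ab: "a \<in> S" "b \<in> S"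
    have "h a b * dist a b * q b * p a = w a b * dist a b"
      using w_p[OF _ ab] w_q[OF _ ab] by (simp add: h_def)
    moreover have "ennreal (h a b) * ennreal (dist a b) * ennreal (q b) * ennreal (p a)
        = ennreal (h a b * dist a b * q b * p a)"
      using h[OF ab] p q by (simp add: ennreal_mult[symmetric])
    ultimately show "ennreal (h a b) * ennreal (dist a b) * ennreal (q b) * ennreal (p a)
        = ennreal (w a b * dist a b)"
      by (simp only:)
  qed
  also have "\<dots> = ennreal (\<Sum>a\<in>S. \<Sum>b\<in>S. w a b * dist a b)"
    using w by (simp add: sum_ennreal sum_nonneg)
  finally have mid: "(\<integral>\<^sup>+z. ennreal (dist (T (fst z)) (T (snd z))) \<partial>\<pi>)
      = ennreal (\<Sum>a\<in>S. \<Sum>b\<in>S. w a b * dist a b)" .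
  have "Wass \<mu> \<nu> \<le> (\<integral>\<^sup>+z. ennreal (dist (fst z) (snd z)) \<partial>\<pi>)"
    unfolding Wass_def using \<pi> by (rule INF_lower)
  \<comment> \<open>The distance is split at the representatives \<open>T (fst z)\<close> and
    \<open>T (snd z)\<close>; the outer terms depend on one coordinate each and see only the
    marginals.\<close>
  also have "\<dots> \<le> (\<integral>\<^sup>+z. ennreal (dist (fst z) (T (fst z))) + ennreal (dist (T (fst z)) (T (snd z)))
      + ennreal (dist (snd z) (T (snd z))) \<partial>\<pi>)"
  proof (intro nn_integral_mono)
    fix z :: "'a \<times> 'a"
    have "dist (fst z) (snd z) \<le> dist (fst z) (T (fst z)) + dist (T (fst z)) (T (snd z)) + dist (snd z) (T (snd z))"
      using dist_triangle[of "fst z" "snd z" "T (fst z)"] dist_triangle[of "T (fst z)" "snd z" "T (snd z)"]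
      by (simp add: dist_commute)
    then show "ennreal (dist (fst z) (snd z)) \<le> ennreal (dist (fst z) (T (fst z)))
        + ennreal (dist (T (fst z)) (T (snd z))) + ennreal (dist (snd z) (T (snd z)))"
      by (simp add: ennreal_plus[symmetric] del: ennreal_plus)
  qed
  also have "\<dots> = (\<integral>\<^sup>+z. ennreal (dist (fst z) (T (fst z))) \<partial>\<pi>)
      + (\<integral>\<^sup>+z. ennreal (dist (T (fst z)) (T (snd z))) \<partial>\<pi>) + (\<integral>\<^sup>+z. ennreal (dist (snd z) (T (snd z))) \<partial>\<pi>)"
    by (simp add: nn_integral_add)
  finally show ?thesis
    unfolding mid using nn_integral_coupling[OF \<pi>, of "\<lambda>x. ennreal (dist x (T x))"] by simp
qed

text \<open>Simple functions \<open>F i\<close> tending to the identity discretise both measures.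
  The displacement \<open>dist x (F i x)\<close> is dominated by a multiple of the distance to a
  base point, so finite first moments make its integral tend to 0, and with it the error made in
  passing to the finite problem and back.\<close>

lemma Wass_le_Lipschitz:
  fixes \<mu> \<nu> :: "'a::polish_space measure"
  assumes \<mu>: "prob_space \<mu>" "\<mu> \<in> finite_first_moment" and \<nu>: "prob_space \<nu>" "\<nu> \<in> finite_first_moment"
    and D: "\<And>f. bounded (range f) \<Longrightarrow> (\<And>x y. \<bar>f x - f y\<bar> \<le> dist x y) \<Longrightarrow>
      (\<integral>x. f x \<partial>\<mu>) - (\<integral>x. f x \<partial>\<nu>) \<le> D"
  shows "Wass \<mu> \<nu> \<le> ennreal D"
proof -
  obtain z :: 'a where True by simp
  obtain F :: "nat \<Rightarrow> 'a \<Rightarrow> 'a" where F: "\<And>i. simple_function borel (F i)" "\<And>x. (\<lambda>i. F i x) \<longlonglongrightarrow> x"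
      "\<And>i x. dist (F i x) z \<le> 2 * dist x z"
    using borel_measurable_implies_sequence_metric[of "\<lambda>x::'a. x" borel z] by auto
  have F_meas[measurable]: "F i \<in> borel \<rightarrow>\<^sub>M borel" for i
    using F(1) by (rule borel_measurable_simple_function)
  have approx: "(\<lambda>i. \<integral>x. dist x (F i x) \<partial>m) \<longlonglongrightarrow> 0 \<and> (\<forall>i. integrable m (\<lambda>x. dist x (F i x)))"
    if m: "m \<in> finite_first_moment" for m
  proof -
    have [measurable_cong]: "sets m = sets borel" and fin: "finite_measure m"
      using m by (auto simp: finite_first_moment_def)
    obtain y where "(\<integral>\<^sup>+u. ennreal (dist y u) \<partial>m) < \<infinity>" using m by (auto simp: finite_first_moment_def)
    then have "integrable m (\<lambda>u. dist y u)" by (intro integrableI_bounded) auto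
    then have int: "integrable m (\<lambda>u. 3 * (dist z y + dist y u))"
      using fin by (auto intro: finite_measure.integrable_const)
    have bd: "dist x (F i x) \<le> 3 * (dist z y + dist y x)" for x i
      using F(3)[of i x] dist_triangle[of x "F i x" z] dist_triangle[of x z y]
      by (simp add: dist_commute)
    have lim: "(\<lambda>i. \<integral>x. dist x (F i x) \<partial>m) \<longlonglongrightarrow> (\<integral>x. 0 \<partial>m)"
    proof (rule integral_dominated_convergence[OF _ _ int])
      show "AE x in m. (\<lambda>i. dist x (F i x)) \<longlonglongrightarrow> 0"
      proof (rule AE_I2)
        fix x
        have "(\<lambda>i. dist x (F i x)) \<longlonglongrightarrow> dist x x" by (intro tendsto_intros F(2))
        then show "(\<lambda>i. dist x (F i x)) \<longlonglongrightarrow> 0" by simp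
      qed
      show "AE x in m. norm (dist x (F i x)) \<le> 3 * (dist z y + dist y x)" for i using bd by simp
    qed auto
    have "integrable m (\<lambda>x. dist x (F i x))" for i
      by (rule Bochner_Integration.integrable_bound[OF int]) (use bd[of _ i] in \<open>auto simp: abs_of_nonneg\<close>)
    with lim show ?thesis by simp
  qed
  interpret \<mu>: prob_space \<mu> by fact
  interpret \<nu>: prob_space \<nu> by fact
  have sets[measurable_cong]: "sets \<mu> = sets borel" "sets \<nu> = sets borel"
    using \<mu> \<nu> by (auto simp: finite_first_moment_def)
  define a where "a i = (\<integral>x. dist x (F i x) \<partial>\<mu>)" for i
  define b where "b i = (\<integral>x. dist x (F i x) \<partial>\<nu>)" for i
  \<comment> \<open>One \<open>a i + b i\<close> comes from testing at representatives in the finite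
    problem, the other from moving the mass of both measures to the representatives.\<close>
  have "Wass \<mu> \<nu> \<le> ennreal (D + 2 * a i + 2 * b i)" for i
  proof -
    let ?T = "F i"
    define S where "S = range ?T"
    have S: "finite S" "S \<noteq> {}" using F(1)[of i] by (auto simp: S_def simple_function_def)
    have vimage[measurable]: "?T -` {c} \<in> sets borel" for c
      using measurable_sets[OF F_meas[of i], of "{c}"] by simp
    have sum_eq: "(\<Sum>x\<in>S. f x * measure m (?T -` {x})) = (\<integral>x. f (?T x) \<partial>m)"
      if "prob_space m" "sets m = sets borel" for m and f :: "'a \<Rightarrow> real"
    proof -
      interpret prob_space m by fact
      have [measurable_cong]: "sets m = sets borel" by fact
      have "f (?T x) = (\<Sum>c\<in>S. f c * indicator (?T -` {c}) x)" for x
      proof -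
        have "(\<Sum>c\<in>S. f c * indicator (?T -` {c}) x) = (\<Sum>c\<in>S. if c = ?T x then f c else 0)"
          by (intro sum.cong) (auto simp: indicator_def)
        then show ?thesis using S by (auto simp: S_def)
      qed
      then have "(\<integral>x. f (?T x) \<partial>m) = (\<integral>x. (\<Sum>c\<in>S. f c * indicator (?T -` {c}) x) \<partial>m)" by simp
      also have "\<dots> = (\<Sum>c\<in>S. f c * measure m (?T -` {c}))"
        by (subst Bochner_Integration.integral_sum) (auto simp: space_eq_UNIV[OF that(2)] less_top[symmetric])
      finally show ?thesis by simp
    qed
    have le: "\<bar>(\<integral>x. f (?T x) \<partial>m) - (\<integral>x. f x \<partial>m)\<bar> \<le> (\<integral>x. dist x (?T x) \<partial>m)"
      if m: "prob_space m" "m \<in> finite_first_moment" and f: "bounded (range f)" "\<And>x y. \<bar>f x - f y\<bar> \<le> dist x y"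
      for m and f :: "'a \<Rightarrow> real"
    proof -
      interpret prob_space m by fact
      have [measurable_cong]: "sets m = sets borel" using m by (auto simp: finite_first_moment_def)
      have [measurable]: "f \<in> borel_measurable borel"
        using Lipschitz_bounded_measurable[OF f] by (rule bounded_measurableD)
      obtain B where B: "\<And>x. norm (f x) \<le> B" using f(1) by (auto simp: bounded_iff)
      have i1: "integrable m (\<lambda>x. f (?T x))" "integrable m f"
        using B by (auto intro!: integrable_const_bound[of _ B])
      then have "(\<integral>x. f (?T x) \<partial>m) - (\<integral>x. f x \<partial>m) = (\<integral>x. f (?T x) - f x \<partial>m)" by simp
      also have "\<bar>\<dots>\<bar> \<le> (\<integral>x. \<bar>f (?T x) - f x\<bar> \<partial>m)" by (rule integral_abs_bound)
      also have "\<dots> \<le> (\<integral>x. dist x (?T x) \<partial>m)"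
        using i1 approx[OF m(2)] f(2)[of "?T _" _, unfolded dist_commute[of "?T _"]]
        by (intro integral_mono) auto
      finally show ?thesis .
    qed
    obtain w where w: "\<forall>x\<in>S. \<forall>y\<in>S. 0 \<le> w x y" "\<forall>x\<in>S. (\<Sum>y\<in>S. w x y) = measure \<mu> (?T -` {x})"
      "\<forall>y\<in>S. (\<Sum>x\<in>S. w x y) = measure \<nu> (?T -` {y})"
      "(\<Sum>x\<in>S. \<Sum>y\<in>S. w x y * dist x y) \<le> D + a i + b i"
    proof (atomize_elim, rule finite_Kantorovich_duality[OF S], goal_cases)
      case (3 f)
      then show ?case
        unfolding sum_eq[OF \<mu>(1) sets(1)] sum_eq[OF \<nu>(1) sets(2)] a_def b_def
        using le[OF \<mu>, of f] le[OF \<nu>, of f] D[of f] by force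
    qed auto
    have "Wass \<mu> \<nu> \<le> (\<integral>\<^sup>+x. dist x (?T x) \<partial>\<mu>) + ennreal (\<Sum>x\<in>S. \<Sum>y\<in>S. w x y * dist x y)
      + (\<integral>\<^sup>+x. dist x (?T x) \<partial>\<nu>)"
      using w by (intro Wass_le_discretised[OF \<mu>(1) sets(1) \<nu>(1) sets(2) F_meas S(1)]) (auto simp: S_def)
    also have "(\<integral>\<^sup>+x. dist x (?T x) \<partial>\<mu>) = ennreal (a i)"
      unfolding a_def using approx[OF \<mu>(2)] by (intro nn_integral_eq_integral) auto
    also have "(\<integral>\<^sup>+x. dist x (?T x) \<partial>\<nu>) = ennreal (b i)"
      unfolding b_def using approx[OF \<nu>(2)] by (intro nn_integral_eq_integral) auto
    also have "ennreal (a i) + ennreal (\<Sum>x\<in>S. \<Sum>y\<in>S. w x y * dist x y) + ennreal (b i)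
        = ennreal (a i + (\<Sum>x\<in>S. \<Sum>y\<in>S. w x y * dist x y) + b i)"
      using w(1) by (simp add: a_def b_def sum_nonneg)
    also have "\<dots> \<le> ennreal (D + 2 * a i + 2 * b i)"
      using w(4) by (intro ennreal_leI) simp
    finally show ?thesis .
  qed
  moreover have "(\<lambda>i. ennreal (D + 2 * a i + 2 * b i)) \<longlonglongrightarrow> ennreal (D + 2 * 0 + 2 * 0)"
    unfolding a_def b_def using approx[OF \<mu>(2)] approx[OF \<nu>(2)] by (intro tendsto_intros) auto
  ultimately show ?thesis by (intro LIMSEQ_le_const[of _ "ennreal D"]) auto
qed

subsection \<open>Semigroups of jump processes\<close>

text \<open>The analytic part of the process: kernels, the Chapman-Kolmogorov equation and the
  derivative at time 0. The limit in \<open>K_generator\<close> is pointwise in \<open>x\<close>;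
  continuity and all inequalities at later times have to be extracted from it.\<close>

locale jump_semigroup =
  fixes q :: "'a::polish_space \<Rightarrow> 'a measure" and K :: "real \<Rightarrow> 'a \<Rightarrow> 'a measure"
  assumes q: "jump_kernel q"
    and K_kernel: "\<And>t. 0 \<le> t \<Longrightarrow> K t \<in> borel \<rightarrow>\<^sub>M prob_algebra borel"
    and K_zero: "\<And>x. K 0 x = return borel x"
    and K_add: "\<And>s t x. 0 \<le> s \<Longrightarrow> 0 \<le> t \<Longrightarrow> K (s + t) x = K s x \<bind> K t"
    and K_generator: "\<And>f x. f \<in> bounded_measurable \<Longrightarrow>
      ((\<lambda>h. ((\<integral>y. f y \<partial>K h x) - f x) / h) \<longlongrightarrow> jump_generator q f x) (at_right 0)"
begin

definition U :: "real \<Rightarrow> ('a \<Rightarrow> real) \<Rightarrow> 'a \<Rightarrow> real" where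
  "U t f x = (\<integral>y. f y \<partial>K t x)"

definition rate :: "'a \<Rightarrow> real" where
  "rate x = measure (q x) UNIV"

abbreviation L :: "('a \<Rightarrow> real) \<Rightarrow> 'a \<Rightarrow> real" where
  "L \<equiv> jump_generator q"

lemma rate_nonneg: "0 \<le> rate x" by (simp add: rate_def)

lemma q_props: "sets (q x) = sets borel" "finite_measure (q x)" "space (q x) = UNIV"
  using q sets_eq_imp_space_eq[of "q x" borel] by (auto simp: jump_kernel_def)

lemma rate_measurable[measurable]: "rate \<in> borel_measurable borel"
proof -
  have "(\<lambda>x. emeasure (q x) UNIV) \<in> borel_measurable borel"
    using q by (simp add: jump_kernel_def)
  then show ?thesis unfolding rate_def measure_def by measurable
qed

lemma K_props:
  assumes "0 \<le> t"
  shows "sets (K t x) = sets borel" "prob_space (K t x)" "finite_measure (K t x)"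
proof -
  have "K t x \<in> space (prob_algebra borel)"
    using measurable_space[OF K_kernel[OF assms], of x] by simp
  then show "sets (K t x) = sets borel" "prob_space (K t x)"
    by (auto simp: space_prob_algebra)
  then show "finite_measure (K t x)" by (simp add: prob_space.finite_measure)
qed

lemma integrable_K: "0 \<le> t \<Longrightarrow> f \<in> bounded_measurable \<Longrightarrow> integrable (K t x) f"
  by (intro integrable_bounded_measurable K_props)

lemma integrable_q: "f \<in> bounded_measurable \<Longrightarrow> integrable (q x) f"
  by (intro integrable_bounded_measurable q_props)

lemma U_const: "0 \<le> t \<Longrightarrow> U t (\<lambda>x. c) x = c"
  using prob_space.prob_space[OF K_props(2)] by (simp add: U_def)

lemma U_zero: "f \<in> bounded_measurable \<Longrightarrow> U 0 f x = f x"
  unfolding U_def K_zero by (subst integral_return) (auto dest: bounded_measurableD)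

lemma U_lincomb:
  "0 \<le> t \<Longrightarrow> f \<in> bounded_measurable \<Longrightarrow> g \<in> bounded_measurable \<Longrightarrow>
    U t (\<lambda>x. a * f x + b * g x) x = a * U t f x + b * U t g x"
  unfolding U_def by (simp add: integrable_K)

lemma U_mono:
  "0 \<le> t \<Longrightarrow> f \<in> bounded_measurable \<Longrightarrow> g \<in> bounded_measurable \<Longrightarrow> (\<And>x. f x \<le> g x) \<Longrightarrow> U t f x \<le> U t g x"
  unfolding U_def by (intro integral_mono integrable_K)

lemma U_abs_le:
  assumes "0 \<le> t" "f \<in> bounded_measurable" "\<And>x. \<bar>f x\<bar> \<le> B"
  shows "\<bar>U t f x\<bar> \<le> B"
proof -
  have "- B \<le> f x" "f x \<le> B" for x using assms(3)[of x] by auto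
  then show ?thesis
    using U_mono[OF assms(1,2) bounded_measurable_const, of B x] U_const[OF assms(1), of B x]
      U_mono[OF assms(1) bounded_measurable_const assms(2), of "-B" x] U_const[OF assms(1), of "-B" x]
    by auto
qed

lemma U_bounded_measurable:
  assumes "0 \<le> t" "f \<in> bounded_measurable"
  shows "U t f \<in> bounded_measurable"
proof -
  obtain B where "\<And>x. \<bar>f x\<bar> \<le> B" using bounded_measurable_obtain_bound[OF assms(2)] by blast
  moreover have "U t f \<in> borel_measurable borel"
    unfolding U_def
    using measurable_compose[OF measurable_prob_algebraD[OF K_kernel[OF assms(1)]]
        integral_measurable_subprob_algebra[OF bounded_measurableD[OF assms(2)]]] by simp
  ultimately show ?thesis using U_abs_le[OF assms, of B] by (intro bounded_measurableI[of _ B]) auto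
qed

lemma U_add:
  assumes "0 \<le> s" "0 \<le> t" "f \<in> bounded_measurable"
  shows "U (s + t) f x = U s (U t f) x"
proof -
  obtain B where B: "\<And>x. \<bar>f x\<bar> \<le> B" using bounded_measurable_obtain_bound[OF assms(3)] by blast
  interpret prob_space "K s x" using K_props[OF assms(1)] by simp
  have "(\<integral>y. f y \<partial>(K s x \<bind> K t)) = (\<integral>y. \<integral>z. f z \<partial>K t y \<partial>K s x)"
  proof (rule integral_bind[where K = borel and B' = 1])
    show "K t \<in> K s x \<rightarrow>\<^sub>M subprob_algebra borel"
      by (subst measurable_cong_sets[OF K_props(1)[OF assms(1)] refl])
         (rule measurable_prob_algebraD[OF K_kernel[OF assms(2)]])
    show "AE y in K s x. emeasure (K t y) (space (K t y)) \<le> ennreal 1"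
      using prob_space.emeasure_space_1[OF K_props(2)[OF assms(2)]] by simp
  qed (use B assms bounded_measurableD in auto, unfold_locales)
  then show ?thesis by (simp add: U_def K_add[OF assms(1,2)])
qed

lemma L_eq:
  assumes "f \<in> bounded_measurable"
  shows "L f x = (\<integral>u. f u \<partial>q x) - rate x * f x"
proof -
  have "L f x = (\<integral>u. f u \<partial>q x) - (\<integral>u. f x \<partial>q x)"
    unfolding jump_generator_def
    by (intro Bochner_Integration.integral_diff integrable_q assms bounded_measurable_const)
  then show ?thesis by (simp add: q_props rate_def)
qed

text \<open>Only the upper half of the derivative is kept, as the maximum principle asks for no
  more. How small \<open>h\<close> must be depends on \<open>f\<close> and \<open>x\<close>.\<close>

lemma U_step_le:
  assumes "f \<in> bounded_measurable" "0 < e"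
  shows "\<forall>\<^sub>F h in at_right 0. U h f x \<le> f x + h * (L f x + e)"
proof -
  have "\<forall>\<^sub>F h in at_right 0. (U h f x - f x) / h < L f x + e"
    using K_generator[OF assms(1), of x] assms(2) unfolding U_def by (intro order_tendstoD) auto
  then show ?thesis using eventually_at_right_less
  proof eventually_elim
    case (elim h)
    then have "U h f x - f x < (L f x + e) * h" by (simp only: divide_less_eq if_True)
    then show ?case by (simp add: mult.commute)
  qed
qed

text \<open>\<open>f y - f x\<close> vanishes at \<open>y = x\<close> and is at most
  \<open>2 * B\<close> in absolute value elsewhere, so the change is controlled by the probability
  of not being at \<open>x\<close>. The bound sees \<open>f\<close> only through \<open>B\<close>,
  hence is common to all functions \<open>U s f\<close>.\<close>

lemma U_near_zero:
  assumes "0 \<le> h" "f \<in> bounded_measurable" "\<And>x. \<bar>f x\<bar> \<le> B"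
  shows "\<bar>U h f x - f x\<bar> \<le> 2 * B * (1 - U h (indicator {x}) x)"
proof -
  let ?I = "indicator {x} :: 'a \<Rightarrow> real"
  have I: "?I \<in> bounded_measurable" by (rule bounded_measurable_indicator) simp
  have bm: "(\<lambda>y. 2 * B * 1 + (- 2 * B) * ?I y) \<in> bounded_measurable"
    by (rule bounded_measurable_lincomb[OF bounded_measurable_const I])
  have rhs: "U h (\<lambda>y. 2 * B * 1 + (- 2 * B) * ?I y) x = 2 * B * (1 - U h ?I x)"
    using U_lincomb[OF assms(1) bounded_measurable_const I, of "2 * B" 1 "- 2 * B" x] U_const[OF assms(1), of 1 x]
    by (simp add: algebra_simps)
  have B: "f y - f x \<le> 2 * B" "f x - f y \<le> 2 * B" for y using assms(3)[of x] assms(3)[of y] by auto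
  have "U h (\<lambda>y. 1 * f y + (-1) * f x) x \<le> U h (\<lambda>y. 2 * B * 1 + (- 2 * B) * ?I y) x"
    using B by (intro U_mono assms bm bounded_measurable_lincomb bounded_measurable_const) (auto simp: indicator_def)
  moreover have "U h (\<lambda>y. (-1) * f y + 1 * f x) x \<le> U h (\<lambda>y. 2 * B * 1 + (- 2 * B) * ?I y) x"
    using B by (intro U_mono assms bm bounded_measurable_lincomb bounded_measurable_const) (auto simp: indicator_def)
  ultimately show ?thesis
    using assms rhs by (simp only: U_lincomb[OF assms(1,2) bounded_measurable_const] U_const)
qed

text \<open>The generator is applied to the indicator of the starting point: a difference quotient
  with a finite limit has a numerator tending to 0.\<close>

lemma U_indicator_tendsto: "((\<lambda>h. 1 - U h (indicator {x}) x) \<longlongrightarrow> 0) (at_right 0)"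
proof -
  let ?I = "indicator {x} :: 'a \<Rightarrow> real"
  have "((\<lambda>h. h * ((U h ?I x - 1) / h)) \<longlongrightarrow> 0 * L ?I x) (at_right 0)"
    using K_generator[OF bounded_measurable_indicator, of "{x}" x] unfolding U_def
    by (intro tendsto_mult) (auto intro!: tendsto_intros)
  moreover have "\<forall>\<^sub>F h in at_right 0. h * ((U h ?I x - 1) / h) = U h ?I x - 1"
    using eventually_at_right_less[of 0] by eventually_elim auto
  ultimately have "((\<lambda>h. U h ?I x - 1) \<longlongrightarrow> 0) (at_right 0)"
    by (simp add: filterlim_cong[OF refl refl])
  from tendsto_minus[OF this] show ?thesis by simp
qed

text \<open>\<open>U (s + h) f\<close> equals \<open>U h (U s f)\<close>, and the bound of
  \<open>U_near_zero\<close> for \<open>U s f\<close> does not involve \<open>s\<close>. This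
  uniformity in the left end point gives continuity from the left as well.\<close>

lemma U_continuous:
  assumes f: "f \<in> bounded_measurable"
  shows "continuous_on {0..} (\<lambda>t. U t f x)"
proof -
  obtain B where B: "0 \<le> B" "\<And>x. \<bar>f x\<bar> \<le> B" using bounded_measurable_obtain_bound[OF f] by blast
  let ?I = "indicator {x} :: 'a \<Rightarrow> real"
  have diff: "\<bar>U (s + h) f x - U s f x\<bar> \<le> 2 * B * (1 - U h ?I x)" if "0 \<le> s" "0 \<le> h" for s h
    using U_near_zero[OF that(2) U_bounded_measurable[OF that(1) f], of B x] U_abs_le[OF that(1) f B(2)]
      U_add[OF that(2,1) f, of x] by (simp add: add.commute)
  show ?thesis
  proof (rule continuous_onI)
    fix t e :: real assume t: "t \<in> {0..}" and e: "0 < e"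
    have "((\<lambda>h. 2 * B * (1 - U h ?I x)) \<longlongrightarrow> 2 * B * 0) (at_right 0)"
      by (intro tendsto_mult tendsto_const U_indicator_tendsto)
    then have "\<forall>\<^sub>F h in at_right 0. 2 * B * (1 - U h ?I x) < e"
      using e by (intro order_tendstoD) auto
    then obtain d where d: "0 < d" "\<And>h. 0 < h \<Longrightarrow> h < d \<Longrightarrow> 2 * B * (1 - U h ?I x) < e"
      unfolding eventually_at_right_field by auto
    have "dist (U s f x) (U t f x) \<le> e" if "0 \<le> s" "dist s t < d" for s
    proof (cases s t rule: linorder_cases)
      case less
      then show ?thesis using diff[of s "t - s"] d(2)[of "t - s"] that by (auto simp: dist_real_def)
    next
      case greater
      then show ?thesis using diff[of t "s - t"] d(2)[of "s - t"] that t by (auto simp: dist_real_def)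
    qed (use e in simp)
    then show "\<exists>d>0. \<forall>s\<in>{0..}. dist s t < d \<longrightarrow> dist (U s f x) (U t f x) \<le> e"
      using d(1) by auto
  qed
qed

end

section \<open>Dyadic times\<close>

definition dyadic_floor :: "nat \<Rightarrow> real \<Rightarrow> nat" where
  "dyadic_floor m t = nat \<lfloor>t * 2 ^ m\<rfloor>"

lemma dyadic_floor_double: "2 * dyadic_floor m t \<le> dyadic_floor (Suc m) t"
  unfolding dyadic_floor_def by (cases "0 \<le> t") (auto intro!: nat_mono simp: le_floor_iff, linarith+)

lemma dyadic_floor_mono: "s \<le> t \<Longrightarrow> dyadic_floor m s \<le> dyadic_floor m t"
  unfolding dyadic_floor_def by (intro nat_mono floor_mono) auto

text \<open>An inequality suffices: inspection times lost when \<open>s + t\<close> is split can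
  only enlarge a survival probability.\<close>

lemma dyadic_floor_add:
  assumes "0 \<le> s" "0 \<le> t"
  shows "dyadic_floor m s + dyadic_floor m t \<le> dyadic_floor m (s + t)"
proof -
  have "\<lfloor>s * 2 ^ m\<rfloor> + \<lfloor>t * 2 ^ m\<rfloor> \<le> \<lfloor>(s + t) * 2 ^ m\<rfloor>"
    by (simp add: distrib_right le_floor_add)
  moreover have "0 \<le> \<lfloor>s * 2 ^ m\<rfloor>" "0 \<le> \<lfloor>t * 2 ^ m\<rfloor>" using assms by auto
  ultimately show ?thesis by (simp add: dyadic_floor_def nat_add_distrib[symmetric] nat_mono)
qed

lemma dyadic_floor_le: "0 \<le> t \<Longrightarrow> real (dyadic_floor m t) / 2 ^ m \<le> t"
  by (simp add: dyadic_floor_def divide_le_eq)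

lemma dyadic_floor_tendsto:
  assumes "0 \<le> t"
  shows "(\<lambda>m. real (dyadic_floor m t) / 2 ^ m) \<longlonglongrightarrow> t"
proof (rule tendsto_sandwich[where f = "\<lambda>m. t - (1 / 2) ^ m" and h = "\<lambda>m. t"])
  have "t - (1 / 2) ^ m \<le> real (dyadic_floor m t) / 2 ^ m" for m
  proof -
    have "t * 2 ^ m - 1 \<le> real (dyadic_floor m t)"
      using assms real_of_int_floor_gt_diff_one[of "t * 2 ^ m"] by (simp add: dyadic_floor_def)
    then have "(t * 2 ^ m - 1) / 2 ^ m \<le> real (dyadic_floor m t) / 2 ^ m"
      by (intro divide_right_mono) auto
    then show ?thesis by (simp add: diff_divide_distrib power_one_over)
  qed
  then show "\<forall>\<^sub>F m in sequentially. t - (1 / 2) ^ m \<le> real (dyadic_floor m t) / 2 ^ m" by simp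
  have "(\<lambda>m. t - (1 / 2) ^ m) \<longlonglongrightarrow> t - 0"
    by (intro tendsto_intros LIMSEQ_realpow_zero) auto
  then show "(\<lambda>m. t - (1 / 2) ^ m) \<longlonglongrightarrow> t" by simp
qed (use dyadic_floor_le[OF assms] in auto)

context jump_semigroup
begin

text \<open>\<open>survival E h k x\<close> is the probability of being in \<open>E\<close> at the times \<open>0, h, \<dots>, k h\<close>, and
  \<open>stay E t x\<close> that of being in \<open>E\<close> at all dyadic times up to \<open>t\<close>.\<close>

primrec survival :: "'a set \<Rightarrow> real \<Rightarrow> nat \<Rightarrow> 'a \<Rightarrow> real" where
  "survival E h 0 = indicator E"
| "survival E h (Suc k) = (\<lambda>x. indicator E x * U h (survival E h k) x)"

definition stay :: "'a set \<Rightarrow> real \<Rightarrow> 'a \<Rightarrow> real" where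
  "stay E t x = (INF m. survival E (1 / 2 ^ m) (dyadic_floor m t) x)"

context
  fixes E :: "'a set"
  assumes E: "E \<in> sets borel"
begin

lemma survival_bounds:
  assumes h: "0 \<le> h"
  shows "survival E h k \<in> bounded_measurable \<and> (\<forall>x. 0 \<le> survival E h k x \<and> survival E h k x \<le> 1)"
proof (induction k)
  case 0
  then show ?case using bounded_measurable_indicator[OF E] by simp
next
  case (Suc k)
  have U: "0 \<le> U h (survival E h k) x" "U h (survival E h k) x \<le> 1" for x
    using U_mono[OF h bounded_measurable_const, of "survival E h k" 0 x]
      U_mono[OF h _ bounded_measurable_const, of "survival E h k" 1 x] U_const[OF h, of _ x] Suc.IH by auto
  have "survival E h (Suc k) \<in> bounded_measurable"
    unfolding survival.simps using Suc.IH
    by (intro bounded_measurable_times bounded_measurable_indicator[OF E] U_bounded_measurable h) simp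
  then show ?case using U by (simp add: indicator_def)
qed

lemmas survival_bm = survival_bounds[THEN conjunct1]

lemma survival_nonneg: "0 \<le> h \<Longrightarrow> 0 \<le> survival E h k x"
  and survival_le_1: "0 \<le> h \<Longrightarrow> survival E h k x \<le> 1"
  using survival_bounds by auto

lemma U_survival_nonneg: "0 \<le> s \<Longrightarrow> 0 \<le> h \<Longrightarrow> 0 \<le> U s (survival E h k) x"
  using U_mono[OF _ bounded_measurable_const survival_bm, of s h 0 k x] survival_nonneg U_const[of s 0 x] by auto

lemma survival_Suc_le_U: "0 \<le> h \<Longrightarrow> survival E h (Suc k) x \<le> U h (survival E h k) x"
  using U_survival_nonneg[of h h k x] by (auto simp: indicator_def)

text \<open>The inspections before time \<open>j * h\<close> are dropped; those at
  \<open>j * h\<close> and later remain.\<close>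

lemma survival_shift:
  assumes h: "0 \<le> h"
  shows "survival E h (k + j) x \<le> U (real j * h) (survival E h k) x"
proof (induction j arbitrary: x)
  case 0
  then show ?case using survival_bm[OF h] by (simp add: U_zero)
next
  case (Suc j)
  have jh: "0 \<le> real j * h" using h by simp
  have "survival E h (k + Suc j) x \<le> U h (survival E h (k + j)) x"
    using survival_Suc_le_U[OF h, of "k + j" x] by simp
  also have "\<dots> \<le> U h (U (real j * h) (survival E h k)) x"
    by (intro U_mono h survival_bm U_bounded_measurable jh Suc.IH)
  also have "\<dots> = U (real (Suc j) * h) (survival E h k) x"
    using U_add[OF h jh survival_bm[OF h]] by (simp add: algebra_simps)
  finally show ?case .
qed

lemma survival_Suc_le:
  assumes h: "0 \<le> h"
  shows "survival E h (Suc k) x \<le> survival E h k x"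
proof (induction k arbitrary: x)
  case 0
  have "U h (survival E h 0) x \<le> 1"
    using U_mono[OF h survival_bm[OF h] bounded_measurable_const, of 0 1 x] survival_le_1[OF h, of 0] U_const[OF h, of 1 x]
    by simp
  then show ?case by (simp add: indicator_def)
next
  case (Suc k)
  have "U h (survival E h (Suc k)) x \<le> U h (survival E h k) x"
    by (intro U_mono h survival_bm Suc.IH)
  then show ?case by (simp add: indicator_def del: survival.simps(2) add: survival.simps(2)[of E h "Suc k"] survival.simps(2)[of E h k])
qed

lemma survival_antimono: "0 \<le> h \<Longrightarrow> k \<le> j \<Longrightarrow> survival E h j x \<le> survival E h k x"
  using lift_Suc_antimono_le[of "\<lambda>k. survival E h k x"] survival_Suc_le by blast

text \<open>The finer grid also inspects the midpoints; \<open>survival_Suc_le_U\<close> drops the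
  inspection at each of them.\<close>

lemma survival_refine:
  assumes h: "0 \<le> h"
  shows "survival E (h / 2) (2 * k) x \<le> survival E h k x"
proof (induction k arbitrary: x)
  case 0
  then show ?case by simp
next
  case (Suc k)
  let ?s = "survival E (h / 2) (2 * k)"
  have h2: "0 \<le> h / 2" using h by simp
  note bm = survival_bm[OF h2, of "2 * k"]
  have "U (h / 2) (survival E (h / 2) (Suc (2 * k))) x \<le> U (h / 2) (U (h / 2) ?s) x"
    by (intro U_mono h2 survival_bm U_bounded_measurable survival_Suc_le_U)
  also have "\<dots> = U h ?s x" using U_add[OF h2 h2 bm] by simp
  also have "\<dots> \<le> U h (survival E h k) x" by (intro U_mono h bm survival_bm Suc.IH)
  finally have "indicator E x * U (h / 2) (survival E (h / 2) (Suc (2 * k))) x \<le> indicator E x * U h (survival E h k) x"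
    by (intro mult_left_mono) auto
  then show ?case by simp
qed

lemma survival_off: "x \<notin> E \<Longrightarrow> survival E h k x = 0"
  by (cases k) auto

lemma survival_dyadic_decseq: "decseq (\<lambda>m. survival E (1 / 2 ^ m) (dyadic_floor m t) x)"
proof (rule decseq_SucI)
  fix m
  have "survival E (1 / 2 ^ Suc m) (dyadic_floor (Suc m) t) x \<le> survival E (1 / 2 ^ Suc m) (2 * dyadic_floor m t) x"
    by (intro survival_antimono dyadic_floor_double) auto
  also have "\<dots> \<le> survival E (1 / 2 ^ m) (dyadic_floor m t) x"
    using survival_refine[of "1 / 2 ^ m" "dyadic_floor m t" x] by (simp add: mult.commute)
  finally show "survival E (1 / 2 ^ Suc m) (dyadic_floor (Suc m) t) x \<le> survival E (1 / 2 ^ m) (dyadic_floor m t) x" .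
qed

lemma bdd_below_survival: "bdd_below (range (\<lambda>m. survival E (1 / 2 ^ m) (dyadic_floor m t) x))"
  by (intro bdd_belowI[of _ 0]) (auto intro: survival_nonneg)

lemma stay_tendsto: "(\<lambda>m. survival E (1 / 2 ^ m) (dyadic_floor m t) x) \<longlonglongrightarrow> stay E t x"
  unfolding stay_def by (rule LIMSEQ_decseq_INF[OF bdd_below_survival survival_dyadic_decseq])

lemma stay_le: "stay E t x \<le> survival E (1 / 2 ^ m) (dyadic_floor m t) x"
  unfolding stay_def by (rule cINF_lower[OF bdd_below_survival]) simp

lemma stay_nonneg: "0 \<le> stay E t x"
  unfolding stay_def by (rule cINF_greatest) (auto intro: survival_nonneg)

lemma stay_le_1: "stay E t x \<le> 1"
  using stay_le[of t x 0] survival_le_1[of 1 "dyadic_floor 0 t" x] by simp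

lemma stay_bm: "stay E t \<in> bounded_measurable"
proof (rule bounded_measurableI)
  show "stay E t \<in> borel_measurable borel"
    by (rule borel_measurable_LIMSEQ_real[OF stay_tendsto], rule bounded_measurableD, rule survival_bm, simp)
  show "\<bar>stay E t x\<bar> \<le> 1" for x using stay_nonneg stay_le_1 by simp
qed

lemma stay_off: "x \<notin> E \<Longrightarrow> stay E t x = 0"
  using stay_le[of t x 0] stay_nonneg[of t x] by (simp add: survival_off)

lemma stay_antimono: "s \<le> t \<Longrightarrow> stay E t x \<le> stay E s x"
  by (rule LIMSEQ_le[OF stay_tendsto stay_tendsto])
     (auto intro!: survival_antimono dyadic_floor_mono)

text \<open>For \<open>1 - stay E\<close> this is the supersolution property of the exit
  probability. The grid points below \<open>t\<close> and \<open>h\<close> need not add up to the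
  one below \<open>t + h\<close>, so at level \<open>m\<close> the shift is by the dyadic time below
  \<open>h\<close>. Continuity of \<open>U\<close> in time moves it to \<open>h\<close>, but only
  for a fixed function: the level \<open>M\<close> is frozen while \<open>m\<close> tends to
  infinity and released afterwards by dominated convergence.\<close>

lemma stay_add_le:
  assumes t: "0 \<le> t" and h: "0 \<le> h"
  shows "stay E (t + h) x \<le> U h (stay E t) x"
proof -
  let ?F = "\<lambda>m. survival E (1 / 2 ^ m) (dyadic_floor m t)"
  have F: "?F m \<in> bounded_measurable" for m by (intro survival_bm) simp
  have le: "stay E (t + h) x \<le> U h (?F M) x" for M
  proof (rule LIMSEQ_le_const)
    have "((\<lambda>s. U s (?F M) x) \<longlongrightarrow> U h (?F M) x) (at h within {0..})"
      using U_continuous[OF F] h by (auto simp: continuous_on_def)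
    then have "continuous (at h within {0..}) (\<lambda>s. U s (?F M) x)" by (simp add: continuous_within)
    then show "(\<lambda>m. U (real (dyadic_floor m h) / 2 ^ m) (?F M) x) \<longlonglongrightarrow> U h (?F M) x"
      by (rule continuous_within_tendsto_compose) (use dyadic_floor_tendsto[OF h] in auto)
    have "stay E (t + h) x \<le> U (real (dyadic_floor m h) / 2 ^ m) (?F M) x" if m: "M \<le> m" for m
    proof -
      have "stay E (t + h) x \<le> survival E (1 / 2 ^ m) (dyadic_floor m (t + h)) x" by (rule stay_le)
      also have "\<dots> \<le> survival E (1 / 2 ^ m) (dyadic_floor m t + dyadic_floor m h) x"
        by (intro survival_antimono dyadic_floor_add t h) simp
      also have "\<dots> \<le> U (real (dyadic_floor m h) * (1 / 2 ^ m)) (?F m) x"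
        by (rule survival_shift) simp
      also have "\<dots> \<le> U (real (dyadic_floor m h) * (1 / 2 ^ m)) (?F M) x"
        using survival_dyadic_decseq m by (intro U_mono F) (auto simp: decseq_def)
      finally show ?thesis by simp
    qed
    then show "\<exists>N. \<forall>m\<ge>N. stay E (t + h) x \<le> U (real (dyadic_floor m h) / 2 ^ m) (?F M) x" by blast
  qed
  have [measurable_cong]: "sets (K h x) = sets borel" using K_props(1)[OF h] .
  have [measurable]: "?F m \<in> borel_measurable borel" "stay E t \<in> borel_measurable borel" for m
    using F stay_bm by (auto intro: bounded_measurableD)
  have "(\<lambda>M. U h (?F M) x) \<longlonglongrightarrow> U h (stay E t) x"
    unfolding U_def
  proof (rule integral_dominated_convergence[where w = "\<lambda>_. 1"])
    show "integrable (K h x) (\<lambda>_. 1::real)" by (intro integrable_K h bounded_measurable_const)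
    show "AE y in K h x. (\<lambda>M. ?F M y) \<longlonglongrightarrow> stay E t y" by (simp add: stay_tendsto)
    show "AE y in K h x. norm (?F M y) \<le> 1" for M using survival_nonneg survival_le_1 by simp
  qed auto
  then show ?thesis by (rule LIMSEQ_le_const) (use le in blast)
qed

end
end

subsection \<open>Contraction under a curvature bound\<close>

lemma nn_integral_add_measure:
  assumes sets: "sets \<nu> = sets \<mu>" and f: "f \<in> borel_measurable \<mu>"
  shows "(\<integral>\<^sup>+x. f x \<partial>add_measure \<mu> \<nu>) = (\<integral>\<^sup>+x. f x \<partial>\<mu>) + (\<integral>\<^sup>+x. f x \<partial>\<nu>)"
  using f
proof induction
  case (cong f g)
  moreover have "space \<nu> = space \<mu>" using sets by (rule sets_eq_imp_space_eq)
  moreover have "space (add_measure \<mu> \<nu>) = space \<mu>" by (rule sets_eq_imp_space_eq) simp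
  ultimately have "integral\<^sup>N M f = integral\<^sup>N M g" if "M \<in> {\<mu>, \<nu>, add_measure \<mu> \<nu>}" for M
    using that cong.hyps(3) by (intro nn_integral_cong) auto
  then show ?case using cong by simp
next
  case (set A)
  then show ?case using sets by (simp add: emeasure_add_measure)
next
  case (mult u c)
  have [measurable]: "u \<in> borel_measurable \<mu>" by fact
  moreover have [measurable_cong]: "sets \<nu> = sets \<mu>" "sets (add_measure \<mu> \<nu>) = sets \<mu>" using sets by auto
  ultimately show ?case using mult.IH by (simp add: nn_integral_cmult distrib_left)
next
  case (add u v)
  have [measurable]: "u \<in> borel_measurable \<mu>" "v \<in> borel_measurable \<mu>" by fact+
  moreover have [measurable_cong]: "sets \<nu> = sets \<mu>" "sets (add_measure \<mu> \<nu>) = sets \<mu>" using sets by auto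
  ultimately show ?case using add.IH by (simp add: nn_integral_add ac_simps)
next
  case (seq F)
  have [measurable]: "F i \<in> borel_measurable \<mu>" for i by (rule seq.hyps)
  have [measurable_cong]: "sets \<nu> = sets \<mu>" "sets (add_measure \<mu> \<nu>) = sets \<mu>" using sets by auto
  have inc: "incseq (\<lambda>i. integral\<^sup>N M (F i))" for M
    using seq.hyps by (auto simp: incseq_def le_fun_def intro!: nn_integral_mono)
  show ?case
    using seq.hyps seq.IH inc
    by (simp add: nn_integral_monotone_convergence_SUP image_comp SUP_apply[abs_def] ennreal_SUP_add)
qed

lemma nn_integral_add_point_mass:
  fixes m :: "'a::polish_space measure"
  assumes m: "sets m = sets borel" and f: "f \<in> borel_measurable borel"
  shows "(\<integral>\<^sup>+u. f u \<partial>add_measure m (scale_measure c (return borel x))) = (\<integral>\<^sup>+u. f u \<partial>m) + c * f x"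
proof -
  have f': "f \<in> borel_measurable m" using f measurable_cong_sets[OF m refl] by blast
  have "(\<integral>\<^sup>+u. f u \<partial>scale_measure c (return borel x)) = c * f x"
    using f by (subst nn_integral_scale_measure) (auto simp: nn_integral_return)
  then show ?thesis using m f' by (subst nn_integral_add_measure) auto
qed

text \<open>Marginal identities of couplings come as nonnegative integrals. Adding a bound
  \<open>B\<close> makes \<open>f\<close> nonnegative, and subtracting the identity for the constant
  \<open>B\<close> undoes it. The map \<open>g\<close> stands for either projection.\<close>

lemma integral_plus_point_of_nn_integral:
  fixes g :: "'b \<Rightarrow> 'a::topological_space"
  assumes M: "finite_measure M" and g: "g \<in> M \<rightarrow>\<^sub>M borel" and m: "finite_measure m" "sets m = sets borel"
    and c: "0 \<le> c"
    and nn: "\<And>f. f \<in> borel_measurable borel \<Longrightarrow> (\<integral>\<^sup>+z. f (g z) \<partial>M) = (\<integral>\<^sup>+u. f u \<partial>m) + ennreal c * f x"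
    and f: "f \<in> bounded_measurable"
  shows "integrable M (\<lambda>z. f (g z))" "(\<integral>z. f (g z) \<partial>M) = (\<integral>u. f u \<partial>m) + c * f x"
proof -
  interpret M: finite_measure M by fact
  note g[measurable]
  have int: "integrable M (\<lambda>z. h (g z))" if h: "h \<in> bounded_measurable" for h
  proof -
    obtain B where "\<And>x. \<bar>h x\<bar> \<le> B" using bounded_measurable_obtain_bound[OF h] by blast
    moreover have [measurable]: "h \<in> borel_measurable borel" using h by (rule bounded_measurableD)
    ultimately show ?thesis by (intro M.integrable_const_bound[of _ B]) auto
  qed
  show "integrable M (\<lambda>z. f (g z))" by (rule int[OF f])
  have nonneg: "(\<integral>z. h (g z) \<partial>M) = (\<integral>u. h u \<partial>m) + c * h x"
    if h: "h \<in> bounded_measurable" "\<And>x. 0 \<le> h x" for h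
  proof -
    have im: "integrable m h" by (rule integrable_bounded_measurable[OF m h(1)])
    have "ennreal (\<integral>z. h (g z) \<partial>M) = (\<integral>\<^sup>+z. h (g z) \<partial>M)"
      using h int[OF h(1)] by (subst nn_integral_eq_integral) auto
    also have "\<dots> = (\<integral>\<^sup>+u. h u \<partial>m) + ennreal c * h x"
      using bounded_measurableD[OF h(1)] by (intro nn) simp
    also have "\<dots> = ennreal ((\<integral>u. h u \<partial>m) + c * h x)"
      using h im c by (subst nn_integral_eq_integral) (auto simp: ennreal_mult integral_nonneg_AE)
    finally show ?thesis
      using h c by (subst (asm) ennreal_inj) (auto intro!: integral_nonneg_AE add_nonneg_nonneg)
  qed
  obtain B where B: "0 \<le> B" "\<And>x. \<bar>f x\<bar> \<le> B" using bounded_measurable_obtain_bound[OF f] by blast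
  have fB: "(\<lambda>x. 1 * f x + 1 * B) \<in> bounded_measurable"
    by (intro bounded_measurable_lincomb f bounded_measurable_const)
  have "0 \<le> f x + B" for x using B(2)[of x] by linarith
  then have "(\<integral>z. 1 * f (g z) + 1 * B \<partial>M) = (\<integral>u. 1 * f u + 1 * B \<partial>m) + c * (1 * f x + 1 * B)"
    by (intro nonneg[OF fB]) simp
  moreover have "(\<integral>z. B \<partial>M) = (\<integral>u. B \<partial>m) + c * B"
    by (rule nonneg[OF bounded_measurable_const B(1)])
  moreover have "(\<integral>z. 1 * f (g z) + 1 * B \<partial>M) = (\<integral>z. f (g z) \<partial>M) + (\<integral>z. B \<partial>M)"
    using int[OF f] int[OF bounded_measurable_const, of B] by (simp only: mult_1 Bochner_Integration.integral_add)
  moreover have "(\<integral>u. 1 * f u + 1 * B \<partial>m) = (\<integral>u. f u \<partial>m) + (\<integral>u. B \<partial>m)"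
    using integrable_bounded_measurable[OF m f] integrable_bounded_measurable[OF m bounded_measurable_const, of B]
    by (simp only: mult_1 Bochner_Integration.integral_add)
  ultimately show "(\<integral>z. f (g z) \<partial>M) = (\<integral>u. f u \<partial>m) + c * f x"
    by (simp only: mult_1 distrib_left)
qed

text \<open>\<open>\<kappa>\<close> is any real upper bound, of either sign, rather than the
  supremum itself. Sample paths enter only through \<open>nonexplosive\<close>.\<close>

locale curved_jump_semigroup = jump_semigroup q K
  for q :: "'a::polish_space \<Rightarrow> 'a measure" and K +
  fixes \<kappa> :: real
  assumes first_moment: "\<And>x. q x \<in> finite_first_moment"
    and curvature: "\<And>x y. x \<noteq> y \<Longrightarrow> J x y (q x) (q y) \<le> ereal (\<kappa> * dist x y)"
    and nonexplosive: "\<And>t x. 0 \<le> t \<Longrightarrow> (\<lambda>n. stay {x. rate x \<le> real n} t x) \<longlonglongrightarrow> 1"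
begin

section \<open>Coupled jumps\<close>

lemma emeasure_q: "emeasure (q x) UNIV = ennreal (rate x)"
  unfolding rate_def by (rule finite_measure.emeasure_eq_measure[OF q_props(2)])

text \<open>A real bound on \<open>J\<close> excludes infinite cost, and the slack \<open>e\<close>
  turns the infimum in \<open>Wass\<close> into an actual plan. That the cost bound is nonnegative
  is recorded because \<open>ennreal\<close> sends negative numbers to 0, so that it is needed to
  return to real inequalities.\<close>

lemma near_optimal_coupling:
  assumes "x \<noteq> y" "0 < e"
  obtains \<pi> :: "('a \<times> 'a) measure" where "finite_measure \<pi>" "sets \<pi> = sets (borel \<Otimes>\<^sub>M borel)"
    "measure \<pi> UNIV = rate x + rate y"
    "\<And>f. f \<in> borel_measurable borel \<Longrightarrow> (\<integral>\<^sup>+z. f (fst z) \<partial>\<pi>) = (\<integral>\<^sup>+u. f u \<partial>q x) + ennreal (rate y) * f x"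
    "\<And>f. f \<in> borel_measurable borel \<Longrightarrow> (\<integral>\<^sup>+z. f (snd z) \<partial>\<pi>) = (\<integral>\<^sup>+u. f u \<partial>q y) + ennreal (rate x) * f y"
    "0 \<le> (\<kappa> + rate x + rate y) * dist x y"
    "(\<integral>\<^sup>+z. ennreal (dist (fst z) (snd z)) \<partial>\<pi>) \<le> ennreal ((\<kappa> + rate x + rate y) * dist x y + e)"
proof -
  let ?\<mu> = "add_measure (q x) (scale_measure (emeasure (q y) UNIV) (return borel x))"
  let ?\<nu> = "add_measure (q y) (scale_measure (emeasure (q x) UNIV) (return borel y))"
  let ?c = "(\<kappa> + rate x + rate y) * dist x y"
  have "enn2ereal (Wass ?\<mu> ?\<nu>) \<le> ereal ?c"
    using curvature[OF assms(1)] unfolding J_def rate_def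
    by (cases "enn2ereal (Wass ?\<mu> ?\<nu>)") (auto simp: algebra_simps)
  moreover from order_trans[OF enn2ereal_nonneg this] have c: "0 \<le> ?c" by simp
  ultimately have "Wass ?\<mu> ?\<nu> \<le> ennreal ?c"
    by (simp add: less_eq_ennreal.rep_eq enn2ereal_ennreal)
  also have "\<dots> < ennreal (?c + e)" using c assms(2) by (intro ennreal_lessI) auto
  finally obtain \<pi> where \<pi>: "\<pi> \<in> couplings ?\<mu> ?\<nu>"
      "(\<integral>\<^sup>+z. ennreal (dist (fst z) (snd z)) \<partial>\<pi>) < ennreal (?c + e)"
    unfolding Wass_def INF_less_iff by blast
  have nn1: "(\<integral>\<^sup>+z. f (fst z) \<partial>\<pi>) = (\<integral>\<^sup>+u. f u \<partial>q x) + ennreal (rate y) * f x" if "f \<in> borel_measurable borel" for f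
    using nn_integral_coupling(1)[OF \<pi>(1) that] nn_integral_add_point_mass[OF q_props(1) that]
    by (simp add: emeasure_q)
  have nn2: "(\<integral>\<^sup>+z. f (snd z) \<partial>\<pi>) = (\<integral>\<^sup>+u. f u \<partial>q y) + ennreal (rate x) * f y" if "f \<in> borel_measurable borel" for f
    using nn_integral_coupling(2)[OF \<pi>(1) that] nn_integral_add_point_mass[OF q_props(1) that]
    by (simp add: emeasure_q)
  have sets: "sets \<pi> = sets (borel \<Otimes>\<^sub>M borel)" using \<pi>(1) by (simp add: couplings_def)
  then have space: "space \<pi> = UNIV" using sets_eq_imp_space_eq[OF sets] by (simp add: space_pair_measure)
  have mass: "emeasure \<pi> UNIV = ennreal (rate x + rate y)"
    using nn1[of "\<lambda>_. 1"] space by (simp add: q_props emeasure_q rate_nonneg)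
  show thesis
  proof (rule that[OF _ sets _ nn1 nn2 c less_imp_le[OF \<pi>(2)]])
    show "finite_measure \<pi>" using mass space by (intro finite_measureI) simp
    show "measure \<pi> UNIV = rate x + rate y" 
      unfolding measure_def mass using rate_nonneg by (intro enn2real_ennreal add_nonneg_nonneg)
  qed
qed

text \<open>The bound by \<open>M\<close> is integrated against the plan. The point masses complete
  the marginal integrals to \<open>L F x + L G y + (rate x + rate y) * (F x + G y)\<close>, and the
  term subtracted in \<open>J\<close> supplies the matching
  \<open>(rate x + rate y) * dist x y\<close>, so of the cost only \<open>\<kappa>\<close> is left
  over. The result has the shape of the step hypothesis of \<open>maximum_principle\<close>.\<close>

lemma generator_pair_le:
  assumes "x \<noteq> y" and F: "F \<in> bounded_measurable" and G: "G \<in> bounded_measurable" and c: "0 \<le> c"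
    and M: "\<And>a b. F a + G b - c * dist a b \<le> M"
  shows "L F x + L G y \<le> (rate x + rate y) * (M - (F x + G y - c * dist x y)) + c * \<kappa> * dist x y"
proof (rule field_le_epsilon)
  fix d :: real assume "0 < d"
  \<comment> \<open>The summand 1 covers the case \<open>c = 0\<close>.\<close>
  define e where "e = d / (c + 1)"
  have e: "0 < e" "c * e \<le> d" using \<open>0 < d\<close> c by (auto simp: e_def field_simps)
  obtain \<pi> :: "('a \<times> 'a) measure" where \<pi>: "finite_measure \<pi>" "sets \<pi> = sets (borel \<Otimes>\<^sub>M borel)"
    "measure \<pi> UNIV = rate x + rate y"
    "\<And>f. f \<in> borel_measurable borel \<Longrightarrow> (\<integral>\<^sup>+z. f (fst z) \<partial>\<pi>) = (\<integral>\<^sup>+u. f u \<partial>q x) + ennreal (rate y) * f x"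
    "\<And>f. f \<in> borel_measurable borel \<Longrightarrow> (\<integral>\<^sup>+z. f (snd z) \<partial>\<pi>) = (\<integral>\<^sup>+u. f u \<partial>q y) + ennreal (rate x) * f y"
    "0 \<le> (\<kappa> + rate x + rate y) * dist x y"
    "(\<integral>\<^sup>+z. ennreal (dist (fst z) (snd z)) \<partial>\<pi>) \<le> ennreal ((\<kappa> + rate x + rate y) * dist x y + e)"
    using near_optimal_coupling[OF assms(1) e(1)] by blast
  interpret \<pi>: finite_measure \<pi> by fact
  have [measurable_cong]: "sets \<pi> = sets (borel \<Otimes>\<^sub>M borel)" by fact
  have space: "space \<pi> = UNIV" using sets_eq_imp_space_eq[OF \<pi>(2)] by (simp add: space_pair_measure)
  note F_int = integral_plus_point_of_nn_integral[OF \<pi>(1) _ q_props(2,1) rate_nonneg \<pi>(4) F, simplified]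
  note G_int = integral_plus_point_of_nn_integral[OF \<pi>(1) _ q_props(2,1) rate_nonneg \<pi>(5) G, simplified]
  have dist_int: "integrable \<pi> (\<lambda>z. dist (fst z) (snd z))"
    using \<pi>(7) by (intro integrableI_bounded) (auto simp: le_less_trans[OF _ ennreal_less_top])
  have "ennreal (\<integral>z. dist (fst z) (snd z) \<partial>\<pi>) \<le> ennreal ((\<kappa> + rate x + rate y) * dist x y + e)"
    using \<pi>(7) dist_int by (subst (asm) nn_integral_eq_integral) auto
  then have cost: "(\<integral>z. dist (fst z) (snd z) \<partial>\<pi>) \<le> (\<kappa> + rate x + rate y) * dist x y + e"
    using \<pi>(6) e(1) by (subst (asm) ennreal_le_iff) auto
  have "(\<integral>z. F (fst z) + G (snd z) - c * dist (fst z) (snd z) \<partial>\<pi>) \<le> (\<integral>z. M \<partial>\<pi>)"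
    using F_int G_int dist_int M by (intro integral_mono) auto
  also have "\<dots> = (rate x + rate y) * M" using \<pi>(3) space by simp
  finally have "(\<integral>z. F (fst z) \<partial>\<pi>) + (\<integral>z. G (snd z) \<partial>\<pi>) - c * (\<integral>z. dist (fst z) (snd z) \<partial>\<pi>) \<le> (rate x + rate y) * M"
    using F_int G_int dist_int by simp
  moreover have "c * (\<integral>z. dist (fst z) (snd z) \<partial>\<pi>) \<le> c * ((\<kappa> + rate x + rate y) * dist x y + e)"
    using cost c by (rule mult_left_mono)
  moreover have "(\<integral>z. F (fst z) \<partial>\<pi>) = (\<integral>u. F u \<partial>q x) + rate y * F x" by (rule F_int)
  moreover have "(\<integral>z. G (snd z) \<partial>\<pi>) = (\<integral>u. G u \<partial>q y) + rate x * G y" by (rule G_int)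
  ultimately show "L F x + L G y \<le> (rate x + rate y) * (M - (F x + G y - c * dist x y)) + c * \<kappa> * dist x y + d"
    using e(2) unfolding L_eq[OF F] L_eq[OF G] by (simp add: algebra_simps)
qed

lemma sublevel_measurable: "{x. rate x \<le> real n} \<in> sets borel"
  using measurable_sets[OF rate_measurable, of "{..real n}"] by (simp add: vimage_def)

lemma U_Lipschitz:
  assumes t: "0 \<le> t" and f: "bounded (range f)" "\<And>x y. \<bar>f x - f y\<bar> \<le> dist x y"
  shows "U t f x - U t f y \<le> exp (\<kappa> * t) * dist x y"
proof -
  have fbm: "f \<in> bounded_measurable" using f by (rule Lipschitz_bounded_measurable)
  obtain B where B: "0 \<le> B" "\<And>x. \<bar>f x\<bar> \<le> B" using bounded_measurable_obtain_bound[OF fbm] by blast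
  note Ubm = U_bounded_measurable[OF _ fbm]
  have UB: "\<bar>U t f x\<bar> \<le> B" if "0 \<le> t" for t x using U_abs_le[OF that fbm B(2)] .
  have killed: "U t f x - U t f y - exp (\<kappa> * t) * dist x y
      - 2 * B * (1 - stay {x. rate x \<le> real n} t x) - 2 * B * (1 - stay {x. rate x \<le> real n} t y) \<le> 0" for n
  proof -
    define E where "E = {x. rate x \<le> real n}"
    have E: "E \<in> sets borel" unfolding E_def by (rule sublevel_measurable)
    note stay_rules = stay_nonneg[OF E] stay_le_1[OF E] stay_off[OF E] stay_antimono[OF E]
    \<comment> \<open>\<open>2 * B\<close> bounds every difference of values of
      \<open>U t f\<close>, so the penalty of one coordinate outside \<open>E\<close>, where
      \<open>stay\<close> is 0, already makes \<open>g\<close> nonpositive.\<close>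
    define g where "g t z = U t f (fst z) - U t f (snd z) - exp (\<kappa> * t) * dist (fst z) (snd z)
      - 2 * B * (1 - stay E t (fst z)) - 2 * B * (1 - stay E t (snd z))" for t and z :: "'a \<times> 'a"
    \<comment> \<open>The diagonal is left out of \<open>D\<close>: the curvature bound speaks of
      distinct points, and at equal points only the nonpositive penalties of \<open>g\<close>
      remain.\<close>
    have "g t (x, y) \<le> 0"
    proof (rule maximum_principle[where g = g and B = "2 * B" and D = "{z. fst z \<noteq> snd z \<and> fst z \<in> E \<and> snd z \<in> E}"
          and l = "\<lambda>z. rate (fst z) + rate (snd z)" and c = "2 * real n"])
      fix t :: real and z :: "'a \<times> 'a" assume t: "0 \<le> t"
      have nonneg: "0 \<le> 2 * B * (1 - stay E t a)" "0 \<le> exp (\<kappa> * t) * dist (fst z) (snd z)" for a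
        using B stay_rules(2)[of t a] by auto
      have U2: "U t f (fst z) - U t f (snd z) \<le> 2 * B"
        using UB[OF t, of "fst z"] UB[OF t, of "snd z"] by linarith
      show "g t z \<le> 2 * B"
        using nonneg(1)[of "fst z"] nonneg(1)[of "snd z"] nonneg(2) U2 unfolding g_def by linarith
      assume "z \<notin> {z. fst z \<noteq> snd z \<and> fst z \<in> E \<and> snd z \<in> E}"
      then consider "fst z = snd z" | "fst z \<notin> E" | "snd z \<notin> E" by auto
      then show "g t z \<le> 0"
      proof cases
        case 1
        then show ?thesis using nonneg(1)[of "fst z"] by (simp add: g_def)
      next
        case 2
        then have "2 * B * (1 - stay E t (fst z)) = 2 * B" by (simp add: stay_rules(3))
        then show ?thesis using nonneg(1)[of "snd z"] nonneg(2) U2 unfolding g_def by linarith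
      next
        case 3
        then have "2 * B * (1 - stay E t (snd z)) = 2 * B" by (simp add: stay_rules(3))
        then show ?thesis using nonneg(1)[of "fst z"] nonneg(2) U2 unfolding g_def by linarith
      qed
    next
      fix z :: "'a \<times> 'a"
      have nonneg: "0 \<le> 2 * B * (1 - stay E 0 a)" for a using B stay_rules(2)[of 0 a] by auto
      have "exp (\<kappa> * 0) * dist (fst z) (snd z) = dist (fst z) (snd z)" by simp
      then show "g 0 z \<le> 0"
        using f(2)[of "fst z" "snd z"] nonneg[of "fst z"] nonneg[of "snd z"] unfolding g_def U_zero[OF fbm]
        by linarith
    next
      fix z :: "'a \<times> 'a" and t e :: real assume t: "0 < t" and e: "0 < e"
      \<comment> \<open>Continuity is known for \<open>?A\<close> only. The penalties grow with time
        because \<open>stay\<close> decreases, so they can only push \<open>g\<close> down, which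
        \<open>left\<close> permits.\<close>
      let ?A = "\<lambda>s. U s f (fst z) - U s f (snd z) - exp (\<kappa> * s) * dist (fst z) (snd z)"
      have "continuous_on {0..} ?A" by (intro continuous_intros U_continuous fbm)
      then have "(?A \<longlongrightarrow> ?A t) (at t within {0..})" using t by (simp add: continuous_on_def)
      then have "(?A \<longlongrightarrow> ?A t) (at t within {0<..})" by (rule tendsto_within_subset) auto
      then have "(?A \<longlongrightarrow> ?A t) (at t)" using t by (simp add: at_within_open[of t "{0<..}"])
      then have "(?A \<longlongrightarrow> ?A t) (at_left t)" by (rule tendsto_within_subset) auto
      then have "\<forall>\<^sub>F s in at_left t. ?A t - e < ?A s" using e by (intro order_tendstoD) auto
      then show "\<forall>\<^sub>F s in at_left t. g t z \<le> g s z + e"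
        using eventually_at_left_real[OF t]
      proof eventually_elim
        case (elim s)
        have "2 * B * (1 - stay E s a) \<le> 2 * B * (1 - stay E t a)" for a
          using B stay_rules(4)[of s t a] elim by (intro mult_left_mono) auto
        from this[of "fst z"] this[of "snd z"] show ?case using elim(1) by (simp add: g_def)
      qed
    next
      fix z :: "'a \<times> 'a" and t M e :: real
      assume z: "z \<in> {z. fst z \<noteq> snd z \<and> fst z \<in> E \<and> snd z \<in> E}" and t: "0 \<le> t"
        and M: "\<And>z'. g t z' \<le> M" and e: "0 < e"
      obtain a b where ab: "z = (a, b)" "a \<noteq> b" using z by (cases z) auto
      \<comment> \<open>\<open>g t\<close> splits into
        \<open>F u + G v - exp (\<kappa> * t) * dist u v - 4 * B\<close>, where \<open>4 * B\<close>
        is the sum of the two penalties at \<open>stay = 0\<close>.\<close>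
      define F where "F u = 1 * U t f u + (2 * B) * stay E t u" for u
      define G where "G u = (-1) * U t f u + (2 * B) * stay E t u" for u
      have F: "F \<in> bounded_measurable" and G: "G \<in> bounded_measurable"
        unfolding F_def G_def by (intro bounded_measurable_lincomb Ubm t stay_bm[OF E])+
      let ?c = "exp (\<kappa> * t)"
      have "F u + G v - ?c * dist u v \<le> M + 4 * B" for u v
        using M[of "(u, v)"] by (simp add: g_def F_def G_def algebra_simps)
      then have "L F a + L G b \<le> (rate a + rate b) * (M + 4 * B - (F a + G b - ?c * dist a b)) + ?c * \<kappa> * dist a b"
        by (intro generator_pair_le ab(2) F G) auto
      moreover have "M + 4 * B - (F a + G b - ?c * dist a b) = M - g t z"
        by (simp add: g_def F_def G_def ab algebra_simps)
      ultimately have gen: "L F a + L G b \<le> (rate a + rate b) * (M - g t z) + ?c * \<kappa> * dist a b"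
        by (simp only:)
      have e2: "0 < e / 2" using e by simp
      show "\<forall>\<^sub>F h in at_right 0. g (t + h) z \<le> g t z + h * ((rate (fst z) + rate (snd z)) * (M - g t z) + e)"
        using U_step_le[OF F e2, of a] U_step_le[OF G e2, of b] eventually_at_right_less
      proof eventually_elim
        case (elim h)
        have h: "0 \<le> h" using elim by simp
        have U_th: "U (h + t) f u = U h (U t f) u" for u
          by (rule U_add[OF h t fbm])
        have UF: "U h F a = U h (U t f) a + 2 * B * U h (stay E t) a"
          unfolding F_def by (subst U_lincomb[OF h Ubm[OF t] stay_bm[OF E]]) simp
        have UG: "U h G b = - U h (U t f) b + 2 * B * U h (stay E t) b"
          unfolding G_def by (subst U_lincomb[OF h Ubm[OF t] stay_bm[OF E]]) simp
        have st: "2 * B * stay E (t + h) u \<le> 2 * B * U h (stay E t) u" for u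
          using B stay_add_le[OF E t h, of u] by (intro mult_left_mono) auto
        \<comment> \<open>By \<open>1 + \<kappa> * h \<le> exp (\<kappa> * h)\<close> the barrier
          lies above its tangent, whatever the sign of \<open>\<kappa>\<close>.\<close>
        have "?c * dist a b * (1 + \<kappa> * h) \<le> ?c * dist a b * exp (\<kappa> * h)"
          by (intro mult_left_mono) auto
        then have ex: "?c * dist a b + h * (?c * \<kappa> * dist a b) \<le> exp (\<kappa> * (t + h)) * dist a b"
          by (simp add: exp_add algebra_simps)
        have "g (t + h) z \<le> U h F a + U h G b - exp (\<kappa> * (t + h)) * dist a b - 4 * B"
          using st[of a] st[of b] by (simp add: g_def ab U_th UF UG algebra_simps)
        also have "\<dots> \<le> (F a + h * (L F a + e / 2)) + (G b + h * (L G b + e / 2))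
            - (?c * dist a b + h * (?c * \<kappa> * dist a b)) - 4 * B"
          using elim ex by linarith
        also have "\<dots> = g t z + h * (L F a + L G b - ?c * \<kappa> * dist a b + e)"
          by (simp add: g_def ab F_def G_def algebra_simps)
        also have "\<dots> \<le> g t z + h * ((rate a + rate b) * (M - g t z) + e)"
          using gen h by (intro add_left_mono mult_left_mono) auto
        finally show ?case by (simp add: ab)
      qed
    qed (use t rate_nonneg in \<open>auto simp: E_def add_nonneg_nonneg\<close>)
    then show ?thesis by (simp add: g_def E_def)
  qed
  have "(\<lambda>n. U t f x - U t f y - exp (\<kappa> * t) * dist x y - 2 * B * (1 - stay {x. rate x \<le> real n} t x)
      - 2 * B * (1 - stay {x. rate x \<le> real n} t y))
    \<longlonglongrightarrow> U t f x - U t f y - exp (\<kappa> * t) * dist x y - 2 * B * (1 - 1) - 2 * B * (1 - 1)"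
    by (intro tendsto_intros nonexplosive t)
  then have "U t f x - U t f y - exp (\<kappa> * t) * dist x y - 2 * B * (1 - 1) - 2 * B * (1 - 1) \<le> 0"
    by (rule LIMSEQ_le_const2) (use killed in blast)
  then show ?thesis by simp
qed

section \<open>First moments\<close>

lemma integrable_dist_q: "integrable (q x) (\<lambda>u. dist u y)"
proof -
  have [measurable_cong]: "sets (q x) = sets borel" by (rule q_props)
  obtain z where "(\<integral>\<^sup>+u. ennreal (dist z u) \<partial>q x) < \<infinity>"
    using first_moment[of x] by (auto simp: finite_first_moment_def)
  then have "integrable (q x) (\<lambda>u. dist z u)" by (intro integrableI_bounded) auto
  then have int: "integrable (q x) (\<lambda>u. dist z u + dist z y)"
    by (intro Bochner_Integration.integrable_add finite_measure.integrable_const[OF q_props(2)])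
  show ?thesis
    by (rule Bochner_Integration.integrable_bound[OF int])
       (auto intro!: AE_I2 dist_triangle3)
qed

text \<open>The triangle inequality through the second coordinate is integrated against the plan of
  jumps from \<open>x\<close> and \<open>y\<close>, where the mass \<open>rate x\<close> at
  \<open>y\<close> contributes nothing. In terms of the generator, the distance to \<open>y\<close>
  has drift at most \<open>\<kappa> * dist x y\<close> plus a constant.\<close>

lemma integral_dist_q_le:
  "(\<integral>u. dist u y \<partial>q x) \<le> (\<kappa> + rate x) * dist x y + (\<integral>u. dist u y \<partial>q y)"
proof (cases "x = y")
  case False
  show ?thesis
  proof (rule field_le_epsilon)
    fix e :: real assume e: "0 < e"
    obtain \<pi> :: "('a \<times> 'a) measure" where \<pi>: "finite_measure \<pi>" "sets \<pi> = sets (borel \<Otimes>\<^sub>M borel)"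
      "measure \<pi> UNIV = rate x + rate y"
      "\<And>f. f \<in> borel_measurable borel \<Longrightarrow> (\<integral>\<^sup>+z. f (fst z) \<partial>\<pi>) = (\<integral>\<^sup>+u. f u \<partial>q x) + ennreal (rate y) * f x"
      "\<And>f. f \<in> borel_measurable borel \<Longrightarrow> (\<integral>\<^sup>+z. f (snd z) \<partial>\<pi>) = (\<integral>\<^sup>+u. f u \<partial>q y) + ennreal (rate x) * f y"
      "0 \<le> (\<kappa> + rate x + rate y) * dist x y"
      "(\<integral>\<^sup>+z. ennreal (dist (fst z) (snd z)) \<partial>\<pi>) \<le> ennreal ((\<kappa> + rate x + rate y) * dist x y + e)"
      using near_optimal_coupling[OF False e] by blast
    have [measurable_cong]: "sets \<pi> = sets (borel \<Otimes>\<^sub>M borel)" by fact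
    have nn: "(\<integral>\<^sup>+u. ennreal (dist u y) \<partial>q w) = ennreal (\<integral>u. dist u y \<partial>q w)" for w
      by (intro nn_integral_eq_integral integrable_dist_q) auto
    have int0: "0 \<le> (\<integral>u. dist u y \<partial>q w)" for w by (intro integral_nonneg_AE) auto
    have "ennreal ((\<integral>u. dist u y \<partial>q x) + rate y * dist x y) = (\<integral>\<^sup>+z. ennreal (dist (fst z) y) \<partial>\<pi>)"
      using \<pi>(4)[of "\<lambda>u. ennreal (dist u y)"] int0 rate_nonneg[of y] by (simp add: nn ennreal_mult)
    also have "\<dots> \<le> (\<integral>\<^sup>+z. ennreal (dist (snd z) y) + ennreal (dist (fst z) (snd z)) \<partial>\<pi>)"
    proof (rule nn_integral_mono)
      fix z :: "'a \<times> 'a"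
      have "dist (fst z) y \<le> dist (snd z) y + dist (fst z) (snd z)"
        using dist_triangle[of "fst z" y "snd z"] by simp
      then show "ennreal (dist (fst z) y) \<le> ennreal (dist (snd z) y) + ennreal (dist (fst z) (snd z))"
        by (simp add: ennreal_plus[symmetric] del: ennreal_plus)
    qed
    also have "\<dots> = (\<integral>\<^sup>+z. ennreal (dist (snd z) y) \<partial>\<pi>) + (\<integral>\<^sup>+z. ennreal (dist (fst z) (snd z)) \<partial>\<pi>)"
      by (intro nn_integral_add) auto
    also have "\<dots> \<le> ennreal (\<integral>u. dist u y \<partial>q y) + ennreal ((\<kappa> + rate x + rate y) * dist x y + e)"
      using \<pi>(5)[of "\<lambda>u. ennreal (dist u y)"] \<pi>(7) by (intro add_mono) (auto simp: nn)
    also have "\<dots> = ennreal ((\<integral>u. dist u y \<partial>q y) + ((\<kappa> + rate x + rate y) * dist x y + e))"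
      using int0[of y] \<pi>(6) e by (intro ennreal_plus[symmetric]) auto
    finally have "(\<integral>u. dist u y \<partial>q x) + rate y * dist x y \<le> (\<integral>u. dist u y \<partial>q y) + ((\<kappa> + rate x + rate y) * dist x y + e)"
      using int0[of y] \<pi>(6) e by (subst (asm) ennreal_le_iff) auto
    then show "(\<integral>u. dist u y \<partial>q x) \<le> (\<kappa> + rate x) * dist x y + (\<integral>u. dist u y \<partial>q y) + e"
      by (simp add: algebra_simps)
  qed
qed simp

text \<open>One-coordinate counterpart of \<open>generator_pair_le\<close>. The distance to
  \<open>y\<close> may be unbounded, but it is integrable against \<open>q x\<close>, so it can be
  subtracted under the integral.\<close>

lemma generator_le:
  assumes F: "F \<in> bounded_measurable" and c: "0 \<le> c" and M: "\<And>a. F a - c * dist a y \<le> M"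
  shows "L F x \<le> rate x * (M - (F x - c * dist x y)) + c * (\<kappa> * dist x y + (\<integral>u. dist u y \<partial>q y))"
proof -
  have "(\<integral>u. F u - c * dist u y \<partial>q x) \<le> (\<integral>u. M \<partial>q x)"
    using M by (intro integral_mono Bochner_Integration.integrable_diff integrable_mult_right integrable_dist_q integrable_q[OF F]
      integrable_q[OF bounded_measurable_const])
  then have "(\<integral>u. F u \<partial>q x) - c * (\<integral>u. dist u y \<partial>q x) \<le> rate x * M"
    by (simp add: integrable_q[OF F] integrable_dist_q q_props rate_def)
  moreover have "c * (\<integral>u. dist u y \<partial>q x) \<le> c * ((\<kappa> + rate x) * dist x y + (\<integral>u. dist u y \<partial>q y))"
    using c by (intro mult_left_mono integral_dist_q_le)
  ultimately show ?thesis unfolding L_eq[OF F] by (simp add: algebra_simps)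
qed

text \<open>The barrier grows at least at the drift \<open>\<kappa> * dist x y\<close> plus
  constant, scaled by its exponential factor. The absolute value of \<open>\<kappa>\<close> is there
  because with a negative exponent the part linear in \<open>t\<close> would decay too fast. The
  bound is free of \<open>R\<close>.\<close>

lemma U_truncated_dist_le:
  assumes t: "0 \<le> t" and R: "0 \<le> R"
  shows "U t (\<lambda>u. min (dist u y) R) x \<le> exp (\<bar>\<kappa>\<bar> * t) * (dist x y + (\<integral>u. dist u y \<partial>q y) * t)"
proof -
  define C where "C = (\<integral>u. dist u y \<partial>q y)"
  have C: "0 \<le> C" unfolding C_def by (intro integral_nonneg_AE) auto
  define f where "f u = min (dist u y) R" for u
  have fB: "\<bar>f u\<bar> \<le> R" for u using R by (auto simp: f_def)
  have fbm: "f \<in> bounded_measurable" using fB by (rule bounded_measurableI[rotated]) (simp add: f_def[abs_def])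
  note Ubm = U_bounded_measurable[OF _ fbm]
  have UB: "U t f x \<le> R" if "0 \<le> t" for t x using U_abs_le[OF that fbm fB, of x] by simp
  define v where "v t x = exp (\<bar>\<kappa>\<bar> * t) * (dist x y + C * t)" for t x
  have killed: "U t f x - v t x - R * (1 - stay {x. rate x \<le> real n} t x) \<le> 0" for n
  proof -
    define E where "E = {x. rate x \<le> real n}"
    have E: "E \<in> sets borel" unfolding E_def by (rule sublevel_measurable)
    note stay_rules = stay_nonneg[OF E] stay_le_1[OF E] stay_off[OF E] stay_antimono[OF E]
    define g where "g t z = U t f z - v t z - R * (1 - stay E t z)" for t z
    have "g t x \<le> 0"
    proof (rule maximum_principle[where g = g and B = R and D = E and l = rate and c = "real n"])
      fix t :: real and z :: 'a assume t: "0 \<le> t"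
      have nonneg: "0 \<le> R * (1 - stay E t z)" "0 \<le> v t z"
        using R C stay_rules(2)[of t z] t by (auto simp: v_def)
      show "g t z \<le> R"
        using nonneg UB[OF t, of z] unfolding g_def by linarith
      assume "z \<notin> E"
      then have "R * (1 - stay E t z) = R" by (simp add: stay_rules(3))
      then show "g t z \<le> 0" using nonneg UB[OF t, of z] unfolding g_def by linarith
    next
      fix z
      have "0 \<le> R * (1 - stay E 0 z)" using R stay_rules(2)[of 0 z] by auto
      moreover have "f z \<le> v 0 z" by (simp add: f_def v_def)
      ultimately show "g 0 z \<le> 0" unfolding g_def U_zero[OF fbm] by linarith
    next
      fix z and t e :: real assume t: "0 < t" and e: "0 < e"
      let ?A = "\<lambda>s. U s f z - v s z"
      have "continuous_on {0..} ?A" unfolding v_def by (intro continuous_intros U_continuous fbm)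
      then have "(?A \<longlongrightarrow> ?A t) (at t within {0..})" using t by (simp add: continuous_on_def)
      then have "(?A \<longlongrightarrow> ?A t) (at t within {0<..})" by (rule tendsto_within_subset) auto
      then have "(?A \<longlongrightarrow> ?A t) (at t)" using t by (simp add: at_within_open[of t "{0<..}"])
      then have "(?A \<longlongrightarrow> ?A t) (at_left t)" by (rule tendsto_within_subset) auto
      then have "\<forall>\<^sub>F s in at_left t. ?A t - e < ?A s" using e by (intro order_tendstoD) auto
      then show "\<forall>\<^sub>F s in at_left t. g t z \<le> g s z + e"
        using eventually_at_left_real[OF t]
      proof eventually_elim
        case (elim s)
        have "R * (1 - stay E s z) \<le> R * (1 - stay E t z)"
          using R stay_rules(4)[of s t z] elim by (intro mult_left_mono) auto
        then show ?case using elim(1) unfolding g_def by linarith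
      qed
    next
      fix z and t M e :: real
      assume t: "0 \<le> t" and M: "\<And>z'. g t z' \<le> M" and e: "0 < e"
      define F where "F u = 1 * U t f u + R * stay E t u" for u
      have F: "F \<in> bounded_measurable"
        unfolding F_def by (intro bounded_measurable_lincomb Ubm t stay_bm[OF E])
      let ?c = "exp (\<bar>\<kappa>\<bar> * t)"
      have "F u - ?c * dist u y \<le> M + R + ?c * C * t" for u
        using M[of u] by (simp add: g_def v_def F_def algebra_simps)
      then have "L F z \<le> rate z * (M + R + ?c * C * t - (F z - ?c * dist z y)) + ?c * (\<kappa> * dist z y + C)"
        unfolding C_def by (intro generator_le F) auto
      moreover have "M + R + ?c * C * t - (F z - ?c * dist z y) = M - g t z"
        by (simp add: g_def v_def F_def algebra_simps)
      ultimately have gen: "L F z \<le> rate z * (M - g t z) + ?c * (\<kappa> * dist z y + C)"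
        by (simp only:)
      show "\<forall>\<^sub>F h in at_right 0. g (t + h) z \<le> g t z + h * (rate z * (M - g t z) + e)"
        using U_step_le[OF F e, of z] eventually_at_right_less
      proof eventually_elim
        case (elim h)
        have h: "0 \<le> h" using elim by simp
        have U_th: "U (h + t) f z = U h (U t f) z"
          by (rule U_add[OF h t fbm])
        have UF: "U h F z = U h (U t f) z + R * U h (stay E t) z"
          unfolding F_def by (subst U_lincomb[OF h Ubm[OF t] stay_bm[OF E]]) simp
        have st: "R * stay E (t + h) z \<le> R * U h (stay E t) z"
          using R stay_add_le[OF E t h, of z] by (intro mult_left_mono) auto
        have "?c * (dist z y + C * (t + h)) * (1 + \<bar>\<kappa>\<bar> * h) \<le> ?c * (dist z y + C * (t + h)) * exp (\<bar>\<kappa>\<bar> * h)"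
          using C t h by (intro mult_left_mono) auto
        then have ex: "?c * (dist z y + C * (t + h)) * (1 + \<bar>\<kappa>\<bar> * h) \<le> v (t + h) z"
          by (simp add: v_def exp_add algebra_simps)
        have "?c * ((dist z y + C * t) + h * (\<kappa> * dist z y + C))
            \<le> ?c * ((dist z y + C * (t + h)) * (1 + \<bar>\<kappa>\<bar> * h))"
        proof (rule mult_left_mono)
          have "h * (\<kappa> * dist z y) \<le> h * (\<bar>\<kappa>\<bar> * dist z y)"
            using h by (intro mult_left_mono mult_right_mono) auto
          moreover have "0 \<le> C * (t + h) * (\<bar>\<kappa>\<bar> * h)" using C t h by auto
          ultimately show "(dist z y + C * t) + h * (\<kappa> * dist z y + C) \<le> (dist z y + C * (t + h)) * (1 + \<bar>\<kappa>\<bar> * h)"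
            by (simp add: algebra_simps)
        qed simp
        then have v: "v t z + h * (?c * (\<kappa> * dist z y + C)) \<le> v (t + h) z"
          using ex by (simp add: v_def algebra_simps)
        have "g (t + h) z \<le> U h F z - v (t + h) z - R"
          using st by (simp add: g_def U_th UF algebra_simps)
        also have "\<dots> \<le> (F z + h * (L F z + e)) - (v t z + h * (?c * (\<kappa> * dist z y + C))) - R"
          using elim v by linarith
        also have "\<dots> = g t z + h * (L F z - ?c * (\<kappa> * dist z y + C) + e)"
          by (simp add: g_def F_def algebra_simps)
        also have "\<dots> \<le> g t z + h * (rate z * (M - g t z) + e)"
          using gen h by (intro add_left_mono mult_left_mono) auto
        finally show ?case .
      qed
    qed (use t rate_nonneg in \<open>auto simp: E_def\<close>)
    then show ?thesis by (simp add: g_def E_def)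
  qed
  have "(\<lambda>n. U t f x - v t x - R * (1 - stay {x. rate x \<le> real n} t x))
    \<longlonglongrightarrow> U t f x - v t x - R * (1 - 1)"
    by (intro tendsto_intros nonexplosive t)
  then have "U t f x - v t x - R * (1 - 1) \<le> 0"
    by (rule LIMSEQ_le_const2) (use killed in blast)
  then show ?thesis by (simp add: v_def f_def[abs_def] C_def)
qed

text \<open>The bound on truncated distances does not depend on the truncation level and passes to
  the monotone limit.\<close>

lemma K_finite_first_moment:
  assumes t: "0 \<le> t"
  shows "K t x \<in> finite_first_moment"
proof -
  have [measurable_cong]: "sets (K t x) = sets borel" by (rule K_props(1)[OF t])
  let ?b = "exp (\<bar>\<kappa>\<bar> * t) * (dist x x + (\<integral>u. dist u x \<partial>q x) * t)"
  let ?f = "\<lambda>n u. min (dist u x) (real n)"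
  have bm: "?f n \<in> bounded_measurable" for n
    by (rule bounded_measurableI[of _ "real n"]) auto
  have "(\<integral>\<^sup>+u. ennreal (?f n u) \<partial>K t x) \<le> ennreal ?b" for n
  proof -
    have "(\<integral>\<^sup>+u. ennreal (?f n u) \<partial>K t x) = ennreal (U t (?f n) x)"
      unfolding U_def by (intro nn_integral_eq_integral integrable_K t bm) auto
    also have "\<dots> \<le> ennreal ?b"
      by (intro ennreal_leI U_truncated_dist_le t) simp
    finally show ?thesis .
  qed
  then have "(SUP n. \<integral>\<^sup>+u. ennreal (?f n u) \<partial>K t x) \<le> ennreal ?b"
    by (intro SUP_least)
  moreover have "(\<integral>\<^sup>+u. (SUP n. ennreal (?f n u)) \<partial>K t x) = (SUP n. \<integral>\<^sup>+u. ennreal (?f n u) \<partial>K t x)"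
    by (intro nn_integral_monotone_convergence_SUP) (auto simp: incseq_def le_fun_def intro!: ennreal_leI)
  moreover have "(\<integral>\<^sup>+u. ennreal (dist u x) \<partial>K t x) \<le> (\<integral>\<^sup>+u. (SUP n. ennreal (?f n u)) \<partial>K t x)"
  proof (rule nn_integral_mono)
    fix u
    obtain n where "dist u x \<le> real n" using real_arch_simple by blast
    then have "ennreal (dist u x) = ennreal (?f n u)" by simp
    also have "\<dots> \<le> (SUP n. ennreal (?f n u))" by (intro SUP_upper) simp
    finally show "ennreal (dist u x) \<le> (SUP n. ennreal (?f n u))" .
  qed
  ultimately have "(\<integral>\<^sup>+u. ennreal (dist x u) \<partial>K t x) < \<infinity>"
    by (simp add: dist_commute[of x]) (meson ennreal_less_top le_less_trans order_trans)
  then show ?thesis using K_props[OF t] by (auto simp: finite_first_moment_def)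
qed

theorem Wass_K_le:
  assumes t: "0 \<le> t"
  shows "Wass (K t x) (K t y) \<le> ennreal (exp (\<kappa> * t) * dist x y)"
proof (rule Wass_le_Lipschitz)
  fix f :: "'a \<Rightarrow> real" assume "bounded (range f)" "\<And>x y. \<bar>f x - f y\<bar> \<le> dist x y"
  from U_Lipschitz[OF t this]
  show "(\<integral>u. f u \<partial>K t x) - (\<integral>u. f u \<partial>K t y) \<le> exp (\<kappa> * t) * dist x y"
    by (simp add: U_def)
qed (use K_props(2) K_finite_first_moment t in auto)

end

subsection \<open>Sample paths\<close>

text \<open>Up to time \<open>t\<close> only the values \<open>p (\<tau> k)\<close> with
  \<open>k < N\<close> occur, whatever \<open>r\<close> is; the sum of the numbers
  \<open>\<bar>r (p (\<tau> k))\<bar>\<close> serves as a bound.\<close>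

lemma step_path_bounded:
  assumes "step_path p" and "0 \<le> t"
  shows "\<exists>n::nat. \<forall>s\<in>{0..t}. (r (p s) :: real) \<le> real n"
proof -
  obtain \<tau> :: "nat \<Rightarrow> real" where \<tau>: "\<tau> 0 = 0" "filterlim \<tau> at_top sequentially"
      "\<And>n s. s \<in> {\<tau> n..<\<tau> (Suc n)} \<Longrightarrow> p s = p (\<tau> n)"
    using assms(1) unfolding step_path_def by blast
  obtain N where N: "t < \<tau> N"
    using \<tau>(2) unfolding filterlim_at_top_dense eventually_sequentially by blast
  obtain n :: nat where n: "(\<Sum>k<N. \<bar>r (p (\<tau> k))\<bar>) \<le> real n" using real_arch_simple by blast
  have "r (p s) \<le> real n" if s: "s \<in> {0..t}" for s
  proof -
    \<comment> \<open>This index is positive because \<open>\<tau> 0 = 0 \<le> s\<close>; its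
      predecessor starts the piece that contains \<open>s\<close>.\<close>
    define m where "m = (LEAST m. s < \<tau> m)"
    have ex: "s < \<tau> N" using s N by auto
    have m: "s < \<tau> m" "m \<le> N" unfolding m_def using ex by (rule LeastI, rule Least_le)
    have "m \<noteq> 0" using m(1) \<tau>(1) s by (intro notI) auto
    then obtain k where k: "m = Suc k" by (cases m) auto
    have "\<not> s < \<tau> k" using not_less_Least[of k "\<lambda>m. s < \<tau> m"] k unfolding m_def by simp
    then have "p s = p (\<tau> k)" using m(1) k by (intro \<tau>(3)) auto
    moreover have "\<bar>r (p (\<tau> k))\<bar> \<le> (\<Sum>k<N. \<bar>r (p (\<tau> k))\<bar>)"
      using m(2) k by (intro member_le_sum) auto
    ultimately show ?thesis using n by (metis abs_le_D1 order_trans)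
  qed
  then show ?thesis by blast
qed

locale jump_process =
  fixes q :: "'a::polish_space \<Rightarrow> 'a measure" and \<Omega> :: "'w measure"
    and P :: "'a \<Rightarrow> 'w measure" and X :: "real \<Rightarrow> 'w \<Rightarrow> 'a"
  assumes kernel: "jump_kernel q" and markov: "markov_process \<Omega> P X"
    and paths: "pure_jump_nonexplosive P X" and generator: "has_generator P X (jump_generator q)"
begin

lemma P_props: "prob_space (P x)" "sets (P x) = sets \<Omega>" "space (P x) = space \<Omega>"
proof -
  show "prob_space (P x)" "sets (P x) = sets \<Omega>" using markov by (auto simp: markov_process_def)
  then show "space (P x) = space \<Omega>" by (intro sets_eq_imp_space_eq) simp
qed

lemma X_measurable:
  assumes "0 \<le> t"
  shows "X t \<in> \<Omega> \<rightarrow>\<^sub>M borel" "X t \<in> P x \<rightarrow>\<^sub>M borel"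
proof -
  show "X t \<in> \<Omega> \<rightarrow>\<^sub>M borel" using markov assms by (simp add: markov_process_def)
  then show "X t \<in> P x \<rightarrow>\<^sub>M borel" by (subst measurable_cong_sets[OF P_props(2) refl])
qed

lemma X_in_event:
  assumes "0 \<le> s" "E \<in> sets borel"
  shows "{\<omega>\<in>space (P x). X s \<omega> \<in> E} \<in> sets (P x)"
  using measurable_sets[OF X_measurable(2)[OF assms(1)] assms(2), of x]
  by (simp add: vimage_def Int_def conj_commute)

lemma transition_kernel: "0 \<le> t \<Longrightarrow> transition P X t \<in> borel \<rightarrow>\<^sub>M prob_algebra borel"
  using markov by (simp add: markov_process_def)

lemma history_sets: "history \<Omega> X s \<subseteq> sets \<Omega>"
  unfolding history_def
  by (rule sets.sigma_sets_subset) (auto intro: measurable_sets[OF X_measurable(1)])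

lemma history_mono: "s \<le> t \<Longrightarrow> history \<Omega> X s \<subseteq> history \<Omega> X t"
  unfolding history_def by (rule sigma_sets_mono') fastforce

lemma history_space: "space \<Omega> \<in> history \<Omega> X s"
  unfolding history_def by (rule sigma_sets_top)

lemma history_Int:
  assumes "A \<in> history \<Omega> X s" "E \<in> sets borel" "0 \<le> s"
  shows "{\<omega>\<in>A. X s \<omega> \<in> E} \<in> history \<Omega> X s"
proof -
  have "sigma_algebra (space \<Omega>) (history \<Omega> X s)"
    unfolding history_def by (rule sigma_algebra_sigma_sets) auto
  then interpret H: sigma_algebra "space \<Omega>" "history \<Omega> X s" .
  have "X s -` E \<inter> space \<Omega> \<in> history \<Omega> X s"
    unfolding history_def using assms by (intro sigma_sets.Basic) auto
  then have "A \<inter> (X s -` E \<inter> space \<Omega>) \<in> history \<Omega> X s" using assms(1) by (rule H.Int[rotated])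
  moreover have "A \<inter> (X s -` E \<inter> space \<Omega>) = {\<omega>\<in>A. X s \<omega> \<in> E}"
    using assms(1) history_sets sets.sets_into_space by blast
  ultimately show ?thesis by simp
qed

lemma Markov_property:
  assumes "0 \<le> s" "0 \<le> t" "A \<in> history \<Omega> X s" "B \<in> sets borel"
  shows "emeasure (P x) {\<omega>\<in>A. X (s + t) \<omega> \<in> B} = (\<integral>\<^sup>+\<omega>\<in>A. emeasure (transition P X t (X s \<omega>)) B \<partial>P x)"
  using markov assms unfolding markov_process_def by blast

text \<open>Conditioning without division: the density \<open>indicator A\<close> restricts
  \<open>P x\<close> to the event, and the Markov property becomes an identity of finite measures on
  the state space. With the whole space as \<open>A\<close> it is the Chapman-Kolmogorov
  equation.\<close>

lemma distr_restricted_history: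
  assumes s: "0 \<le> s" and t: "0 \<le> t" and A: "A \<in> history \<Omega> X s"
  shows "distr (density (P x) (indicator A)) borel (X (s + t))
    = distr (density (P x) (indicator A)) borel (X s) \<bind> transition P X t"
proof (rule measure_eqI)
  have A': "A \<in> sets (P x)" using A history_sets P_props(2) by blast
  note [measurable] = A' X_measurable(2)[OF s, of x] X_measurable(2)[of "s + t" x]
  let ?D = "density (P x) (indicator A)"
  have st: "0 \<le> s + t" using s t by simp
  have sub: "transition P X t \<in> borel \<rightarrow>\<^sub>M subprob_algebra borel"
    by (rule measurable_prob_algebraD[OF transition_kernel[OF t]])
  have sub': "transition P X t \<in> distr ?D borel (X s) \<rightarrow>\<^sub>M subprob_algebra borel" using sub by simp
  show "sets (distr ?D borel (X (s + t))) = sets (distr ?D borel (X s) \<bind> transition P X t)"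
    by (subst sets_bind[where N = borel]) (auto simp: transition_def)
  fix B assume "B \<in> sets (distr ?D borel (X (s + t)))"
  then have B[measurable]: "B \<in> sets borel" by simp
  have em[measurable]: "(\<lambda>y. emeasure (transition P X t y) B) \<in> borel_measurable borel"
    by (rule measurable_emeasure_subprob_algebra[OF B, THEN measurable_compose[OF sub]])
  have AS: "A \<subseteq> space (P x)" using A' by (rule sets.sets_into_space)
  have mB: "X (s + t) -` B \<inter> space (P x) \<in> sets (P x)"
    using X_measurable(2)[OF st] B by (rule measurable_sets)
  have "emeasure (distr ?D borel (X (s + t))) B = emeasure ?D (X (s + t) -` B \<inter> space (P x))"
    using X_measurable(2)[OF st, of x] by (subst emeasure_distr) auto
  also have "\<dots> = (\<integral>\<^sup>+\<omega>. indicator A \<omega> * indicator (X (s + t) -` B \<inter> space (P x)) \<omega> \<partial>P x)"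
    using mB by (subst emeasure_density) auto
  also have "\<dots> = (\<integral>\<^sup>+\<omega>. indicator {\<omega>\<in>A. X (s + t) \<omega> \<in> B} \<omega> \<partial>P x)"
    using AS by (intro nn_integral_cong) (auto simp: indicator_def)
  also have "\<dots> = emeasure (P x) {\<omega>\<in>A. X (s + t) \<omega> \<in> B}"
  proof (rule nn_integral_indicator)
    have "{\<omega>\<in>A. X (s + t) \<omega> \<in> B} = A \<inter> (X (s + t) -` B \<inter> space (P x))" using AS by auto
    then show "{\<omega>\<in>A. X (s + t) \<omega> \<in> B} \<in> sets (P x)" using A' mB by simp
  qed
  also have "\<dots> = (\<integral>\<^sup>+\<omega>\<in>A. emeasure (transition P X t (X s \<omega>)) B \<partial>P x)"
    by (rule Markov_property[OF s t A B])
  also have "\<dots> = (\<integral>\<^sup>+\<omega>. emeasure (transition P X t (X s \<omega>)) B \<partial>?D)"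
    by (subst nn_integral_density) (auto intro!: nn_integral_cong simp: mult.commute measurable_compose[OF X_measurable(2)[OF s] em])
  also have "\<dots> = (\<integral>\<^sup>+y. emeasure (transition P X t y) B \<partial>distr ?D borel (X s))"
    using X_measurable(2)[OF s, of x] em by (subst nn_integral_distr) auto
  also have "\<dots> = emeasure (distr ?D borel (X s) \<bind> transition P X t) B"
    using sub' B by (subst emeasure_bind) auto
  finally show "emeasure (distr ?D borel (X (s + t))) B = emeasure (distr ?D borel (X s) \<bind> transition P X t) B" .
qed

lemma nn_integral_Markov:
  assumes s: "0 \<le> s" and t: "0 \<le> t" and A: "A \<in> history \<Omega> X s" and f: "f \<in> borel_measurable borel"
  shows "(\<integral>\<^sup>+\<omega>\<in>A. f (X (s + t) \<omega>) \<partial>P x) = (\<integral>\<^sup>+\<omega>\<in>A. (\<integral>\<^sup>+y. f y \<partial>transition P X t (X s \<omega>)) \<partial>P x)"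
proof -
  have A': "A \<in> sets (P x)" using A history_sets P_props(2) by blast
  let ?D = "density (P x) (indicator A)"
  have st: "0 \<le> s + t" using s t by simp
  have sub: "transition P X t \<in> borel \<rightarrow>\<^sub>M subprob_algebra borel"
    by (rule measurable_prob_algebraD[OF transition_kernel[OF t]])
  have sub': "transition P X t \<in> distr ?D borel (X s) \<rightarrow>\<^sub>M subprob_algebra borel" using sub by simp
  have dens: "(\<integral>\<^sup>+\<omega>\<in>A. g (X r \<omega>) \<partial>P x) = (\<integral>\<^sup>+y. g y \<partial>distr ?D borel (X r))"
    if g: "g \<in> borel_measurable borel" and r: "0 \<le> r" for g :: "'a \<Rightarrow> ennreal" and r
  proof -
    have "(\<integral>\<^sup>+y. g y \<partial>distr ?D borel (X r)) = (\<integral>\<^sup>+\<omega>. g (X r \<omega>) \<partial>?D)"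
      using X_measurable(2)[OF r, of x] g by (subst nn_integral_distr) auto
    also have "\<dots> = (\<integral>\<^sup>+\<omega>. indicator A \<omega> * g (X r \<omega>) \<partial>P x)"
      using A' measurable_compose[OF X_measurable(2)[OF r] g] by (subst nn_integral_density) auto
    finally show ?thesis by (simp add: mult.commute)
  qed
  have inner: "(\<lambda>z. \<integral>\<^sup>+y. f y \<partial>transition P X t z) \<in> borel_measurable borel"
    by (rule measurable_compose[OF sub nn_integral_measurable_subprob_algebra[OF f]])
  show ?thesis
    unfolding dens[OF f st] dens[OF inner s] distr_restricted_history[OF s t A]
    by (rule nn_integral_bind[OF f sub'])
qed

sublocale jump_semigroup q "transition P X"
proof
  fix x
  have "AE \<omega> in P x. X 0 \<omega> = x" using markov by (simp add: markov_process_def)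
  then have "transition P X 0 x = distr (P x) borel (\<lambda>_. x)"
    unfolding transition_def using X_measurable(2)[of 0 x] by (intro distr_cong_AE) auto
  then show "transition P X 0 x = return borel x"
    using prob_space.distr_const[OF P_props(1), of x borel x] by simp
next
  fix s t :: real and x assume s: "0 \<le> s" and t: "0 \<le> t"
  have "density (P x) (indicator (space \<Omega>)) = density (P x) (\<lambda>_. 1)"
    unfolding P_props(3)[of x, symmetric] by (intro density_cong) auto
  then have "density (P x) (indicator (space \<Omega>)) = P x" by (simp add: density_1)
  then show "transition P X (s + t) x = transition P X s x \<bind> transition P X t"
    using distr_restricted_history[OF s t history_space, of x] by (simp add: transition_def)
next
  fix f :: "'a \<Rightarrow> real" and x assume f: "f \<in> bounded_measurable"
  have lim: "((\<lambda>t. ((\<integral>\<omega>. f (X t \<omega>) \<partial>P x) - f x) / t) \<longlongrightarrow> jump_generator q f x) (at_right 0)"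
    using generator f unfolding has_generator_def bounded_measurable_def by blast
  have "(\<integral>y. f y \<partial>transition P X h x) = (\<integral>\<omega>. f (X h \<omega>) \<partial>P x)" if "0 < h" for h
    unfolding transition_def
    using X_measurable(2)[of h x] that bounded_measurableD[OF f] by (intro integral_distr) auto
  then have "\<forall>\<^sub>F h in at_right 0. ((\<integral>\<omega>. f (X h \<omega>) \<partial>P x) - f x) / h = ((\<integral>y. f y \<partial>transition P X h x) - f x) / h"
    by (intro eventually_mono[OF eventually_at_right_less[of "0::real"]]) simp
  with lim show "((\<lambda>h. ((\<integral>y. f y \<partial>transition P X h x) - f x) / h) \<longlongrightarrow> jump_generator q f x) (at_right 0)"
    by (rule Lim_transform_eventually)
qed (use kernel transition_kernel in auto)

text \<open>The induction needs an arbitrary start time \<open>s\<close> and history event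
  \<open>A\<close>: the inspection at time \<open>s\<close> is absorbed into the event, and the
  Markov property moves on to \<open>s + h\<close>.\<close>

lemma survival_eq_prob:
  assumes E: "E \<in> sets borel" and h: "0 \<le> h" and s: "0 \<le> s" and A: "A \<in> history \<Omega> X s"
  shows "(\<integral>\<^sup>+\<omega>\<in>A. ennreal (survival E h k (X s \<omega>)) \<partial>P x)
    = emeasure (P x) {\<omega>\<in>A. \<forall>i\<le>k. X (s + real i * h) \<omega> \<in> E}"
  using s A
proof (induction k arbitrary: s A)
  case (0 s A)
  have A': "{\<omega>\<in>A. X s \<omega> \<in> E} \<in> sets (P x)"
    using history_Int[OF 0(2) E 0(1)] history_sets P_props(2) by blast
  have "(\<integral>\<^sup>+\<omega>\<in>A. ennreal (survival E h 0 (X s \<omega>)) \<partial>P x) = (\<integral>\<^sup>+\<omega>. indicator {\<omega>\<in>A. X s \<omega> \<in> E} \<omega> \<partial>P x)"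
    by (intro nn_integral_cong) (auto simp: indicator_def)
  then show ?case using A' by simp
next
  case (Suc k s A)
  define A' where "A' = {\<omega>\<in>A. X s \<omega> \<in> E}"
  have A': "A' \<in> history \<Omega> X s" unfolding A'_def by (rule history_Int[OF Suc.prems(2) E Suc.prems(1)])
  have sh: "0 \<le> s + h" using Suc.prems h by simp
  have A'_sh: "A' \<in> history \<Omega> X (s + h)" using A' history_mono[of s "s + h"] h by auto
  have U_eq: "ennreal (U h (survival E h k) y) = (\<integral>\<^sup>+z. ennreal (survival E h k z) \<partial>transition P X h y)" for y
    unfolding U_def using survival_nonneg[OF E h]
    by (intro nn_integral_eq_integral[symmetric] integrable_K h survival_bm E) auto
  have "(\<integral>\<^sup>+\<omega>\<in>A. ennreal (survival E h (Suc k) (X s \<omega>)) \<partial>P x)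
      = (\<integral>\<^sup>+\<omega>\<in>A'. (\<integral>\<^sup>+z. ennreal (survival E h k z) \<partial>transition P X h (X s \<omega>)) \<partial>P x)"
    unfolding U_eq[symmetric] by (intro nn_integral_cong) (auto simp: indicator_def A'_def)
  also have "\<dots> = (\<integral>\<^sup>+\<omega>\<in>A'. ennreal (survival E h k (X (s + h) \<omega>)) \<partial>P x)"
    using bounded_measurableD[OF survival_bm[OF E h]]
    by (intro nn_integral_Markov[symmetric] A' Suc.prems h) simp
  also have "\<dots> = emeasure (P x) {\<omega>\<in>A'. \<forall>i\<le>k. X (s + h + real i * h) \<omega> \<in> E}"
    by (rule Suc.IH[OF sh A'_sh])
  also have "{\<omega>\<in>A'. \<forall>i\<le>k. X (s + h + real i * h) \<omega> \<in> E} = {\<omega>\<in>A. \<forall>i\<le>Suc k. X (s + real i * h) \<omega> \<in> E}"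
  proof -
    have "(\<forall>i\<le>Suc k. Q i) \<longleftrightarrow> Q 0 \<and> (\<forall>i\<le>k. Q (Suc i))" for Q
      by (metis Suc_le_mono le0 not0_implies_Suc)
    then show ?thesis by (simp add: A'_def algebra_simps)
  qed
  finally show ?case .
qed

lemma survival_eq_measure:
  assumes E: "E \<in> sets borel" and h: "0 \<le> h"
  shows "survival E h k x = measure (P x) {\<omega>\<in>space \<Omega>. \<forall>i\<le>k. X (real i * h) \<omega> \<in> E}"
proof -
  interpret prob_space "P x" by (rule P_props)
  have "AE \<omega> in P x. X 0 \<omega> = x" using markov by (simp add: markov_process_def)
  then have "AE \<omega> in P x. ennreal (survival E h k (X 0 \<omega>)) * indicator (space \<Omega>) \<omega> = ennreal (survival E h k x)"
    using AE_space by eventually_elim (simp add: P_props(3))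
  then have "(\<integral>\<^sup>+\<omega>\<in>space \<Omega>. ennreal (survival E h k (X 0 \<omega>)) \<partial>P x) = (\<integral>\<^sup>+\<omega>. ennreal (survival E h k x) \<partial>P x)"
    by (rule nn_integral_cong_AE)
  also have "\<dots> = ennreal (survival E h k x)" by (simp add: emeasure_space_1)
  finally have "ennreal (survival E h k x) = emeasure (P x) {\<omega>\<in>space \<Omega>. \<forall>i\<le>k. X (real i * h) \<omega> \<in> E}"
    using survival_eq_prob[OF E h order_refl history_space, where k = k and x = x] by simp
  then show ?thesis using survival_nonneg[OF E h] by (simp add: emeasure_eq_measure)
qed

text \<open>\<open>S n\<close>, the paths with rate at most \<open>n\<close> at all dyadic times up
  to \<open>t\<close>, is a countable intersection, hence measurable, and is contained in every
  event whose probability enters \<open>stay\<close>. By \<open>step_path_bounded\<close> almost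
  every path lies in some \<open>S n\<close>.\<close>

lemma stay_sublevel_tendsto:
  assumes t: "0 \<le> t"
  shows "(\<lambda>n. stay {x. rate x \<le> real n} t x) \<longlonglongrightarrow> 1"
proof -
  interpret prob_space "P x" by (rule P_props)
  define E where "E n = {x. rate x \<le> real n}" for n
  have E: "E n \<in> sets borel" for n
    unfolding E_def using measurable_sets[OF rate_measurable, of "{..real n}"] by (simp add: vimage_def)
  define S where "S n = {\<omega>\<in>space (P x). \<forall>i m. real i / 2 ^ m \<le> t \<longrightarrow> X (real i / 2 ^ m) \<omega> \<in> E n}" for n
  have S: "S n \<in> events" for n
    unfolding S_def
  proof (intro sets.sets_Collect_countable_All)
    fix i m :: nat
    show "{\<omega>\<in>space (P x). real i / 2 ^ m \<le> t \<longrightarrow> X (real i / 2 ^ m) \<omega> \<in> E n} \<in> events"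
      using X_in_event[OF _ E, of "real i / 2 ^ m" x n] by (cases "real i / 2 ^ m \<le> t") auto
  qed
  have "E m \<subseteq> E n" if "m \<le> n" for m n
  proof -
    have "real m \<le> real n" using that by simp
    then show ?thesis unfolding E_def by (auto intro: order_trans)
  qed
  then have "incseq S" unfolding incseq_def S_def by blast
  then have "(\<lambda>n. prob (S n)) \<longlonglongrightarrow> prob (\<Union>n. S n)"
    using S by (intro finite_Lim_measure_incseq) auto
  moreover have "prob (\<Union>n. S n) = 1"
  proof -
    have "AE \<omega> in P x. step_path (\<lambda>t. X t \<omega>)" using paths by (simp add: pure_jump_nonexplosive_def)
    then have "AE \<omega> in P x. \<omega> \<in> (\<Union>n. S n)"
      using AE_space
    proof eventually_elim
      case (elim \<omega>)
      obtain n :: nat where "\<forall>s\<in>{0..t}. rate (X s \<omega>) \<le> real n"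
        using step_path_bounded[OF elim(1) t, of rate] by blast
      then have "\<omega> \<in> S n" using elim(2) by (auto simp: S_def E_def)
      then show ?case by blast
    qed
    then show ?thesis using S by (intro prob_eq_1[THEN iffD2]) auto
  qed
  ultimately have lim: "(\<lambda>n. prob (S n)) \<longlonglongrightarrow> 1" by simp
  have le: "prob (S n) \<le> stay (E n) t x" for n
    unfolding stay_def
  proof (rule cINF_greatest)
    fix m
    have "S n \<subseteq> {\<omega>\<in>space \<Omega>. \<forall>i\<le>dyadic_floor m t. X (real i * (1 / 2 ^ m)) \<omega> \<in> E n}"
    proof safe
      fix \<omega> i assume \<omega>: "\<omega> \<in> S n" and i: "i \<le> dyadic_floor m t"
      have "real i / 2 ^ m \<le> real (dyadic_floor m t) / 2 ^ m" using i by (intro divide_right_mono) auto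
      then have "real i / 2 ^ m \<le> t" using dyadic_floor_le[OF t, of m] by linarith
      then show "X (real i * (1 / 2 ^ m)) \<omega> \<in> E n" using \<omega> by (simp add: S_def)
    qed (simp add: S_def P_props)
    moreover have "{\<omega>\<in>space \<Omega>. \<forall>i\<le>dyadic_floor m t. X (real i * (1 / 2 ^ m)) \<omega> \<in> E n} \<in> events"
      unfolding P_props(3)[of x, symmetric]
      by (intro sets.sets_Collect_countable_All sets.sets_Collect_imp X_in_event E) auto
    moreover have "survival (E n) (1 / 2 ^ m) (dyadic_floor m t) x
        = prob {\<omega>\<in>space \<Omega>. \<forall>i\<le>dyadic_floor m t. X (real i * (1 / 2 ^ m)) \<omega> \<in> E n}"
      by (rule survival_eq_measure[OF E]) simp
    ultimately show "prob (S n) \<le> survival (E n) (1 / 2 ^ m) (dyadic_floor m t) x"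
      by (simp only: finite_measure_mono)
  qed simp
  show ?thesis
    unfolding E_def[symmetric]
    by (rule tendsto_sandwich[OF _ _ lim tendsto_const]) (use le stay_le_1[OF E] in auto)
qed

end

theorem corollary2p5:
  fixes q :: "'a::polish_space \<Rightarrow> 'a measure"
    and \<Omega> :: "'w measure"
    and P :: "'a \<Rightarrow> 'w measure"
    and X :: "real \<Rightarrow> 'w \<Rightarrow> 'a"
  assumes "jump_kernel q"
    and "\<And>x. q x \<in> finite_first_moment"
    and "markov_process \<Omega> P X"
    and "pure_jump_nonexplosive P X"
    and "has_generator P X (jump_generator q)"
  shows "coarse_ricci P X \<ge>
    - (SUP (x, y)\<in>{(x, y). x \<noteq> y}. J x y (q x) (q y) / ereal (dist x y))"
proof -
  interpret jump_process q \<Omega> P X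
    by unfold_locales (use assms in auto)
  define \<kappa> where "\<kappa> = (SUP (x, y)\<in>{(x, y). x \<noteq> y}. J x y (q x) (q y) / ereal (dist x y))"
  have J_le: "J x y (q x) (q y) / ereal (dist x y) \<le> \<kappa>" if "x \<noteq> y" for x y
    unfolding \<kappa>_def using that by (intro SUP_upper2[of "(x, y)"]) auto
  \<comment> \<open>The bound \<open>k\<close> is left open: it is 0 on a one-point space, and the
    supremum when that is real.\<close>
  have curved: "curved_jump_semigroup q (transition P X) k"
    if "\<And>x y. x \<noteq> y \<Longrightarrow> J x y (q x) (q y) \<le> ereal (k * dist x y)" for k
    by unfold_locales (use assms(2) that stay_sublevel_tendsto in auto)
  show ?thesis
  proof (cases "\<exists>x y :: 'a. x \<noteq> y")
    case False
    \<comment> \<open>On a one-point space the supremum runs over the empty set and is -\<infinity>,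
      so the curvature has to be \<infinity>; this holds as all costs are 0.\<close>
    have W0: "Wass (transition P X t x) (transition P X t y) \<le> 0" if "0 \<le> t" for t x y
    proof -
      have "x = y" using False by metis
      moreover have "curved_jump_semigroup q (transition P X) 0" by (rule curved) (use False in blast)
      ultimately show ?thesis using curved_jump_semigroup.Wass_K_le[OF _ that, of q "transition P X" 0 x y] by simp
    qed
    have "Wass (transition P X t x) (transition P X t y) \<le> exp_ext (- \<infinity> * ereal t) * ennreal (dist x y)"
      if "0 \<le> t" for t x y
      by (rule order_trans[OF W0[OF that] zero_le])
    then have "coarse_ricci P X \<ge> \<infinity>" unfolding coarse_ricci_def by (intro Sup_upper) auto
    then show ?thesis by simp
  next
    case True
    then obtain a b :: 'a where ab: "a \<noteq> b" by blast
    show ?thesis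
    proof (cases \<kappa>)
      case (real k)
      have "J x y (q x) (q y) \<le> ereal (k * dist x y)" if "x \<noteq> y" for x y
        using J_le[OF that] that unfolding real by (subst (asm) ereal_divide_le_pos) (auto simp: mult.commute)
      note W = curved_jump_semigroup.Wass_K_le[OF curved[OF this]]
      have "ereal (- k) \<le> coarse_ricci P X"
        unfolding coarse_ricci_def
        by (intro Sup_upper) (auto intro!: order_trans[OF W] simp: ennreal_mult)
      then show ?thesis unfolding \<kappa>_def[symmetric] real by simp
    next
      case PInf
      then show ?thesis unfolding \<kappa>_def[symmetric] by simp
    next
      case MInf
      \<comment> \<open>\<open>Wass\<close> is nonnegative and the term subtracted in
        \<open>J\<close> is real, so a supremum over a nonempty set of pairs cannot be
        -\<infinity>.\<close>
      have "J a b (q a) (q b) \<noteq> - \<infinity>"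
        unfolding J_def by (cases "Wass (add_measure (q a) (scale_measure (emeasure (q b) UNIV) (return borel a)))
          (add_measure (q b) (scale_measure (emeasure (q a) UNIV) (return borel b)))") auto
      then have "J a b (q a) (q b) / ereal (dist a b) \<noteq> - \<infinity>"
        using ab by (cases "J a b (q a) (q b)") auto
      then show ?thesis using J_le[OF ab] MInf by simp
    qed
  qed
qed

end
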